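(* Assuming the Orthogonal Vectors Conjecture, for no $\epsilon>0$ is there an algorithm with running time $O(m^{2-\epsilon})$ or $O((k\cdot m)^{1-\epsilon})$ for computing the almost-sure winning set of a disjunctive query of $k$ reachability objectives in MDPs with $m$ edges. In particular, there is no such algorithm deciding whether this winning set is non-empty or deciding whether a specific vertex is in it.
   Context: An MDP $P=((V,E),(V_1,V_R),\delta)$: finite directed graph $(V,E)$, vertices partitioned into player-1 vertices $V_1$ and random vertices $V_R$, and for each $v\in V_R$ a probability distribution $\delta(v)$ over its out-neighbours (positive on each). A player-1 strategy maps finite path prefixes ending in $V_1$ to a successor. $\langle\langle 1\rangle\rangle_{as}(P,\psi)$ is the set of vertices from which player 1 has a strategy achieving objective $\psi$ with probability 1. $\mathrm{Reach}(T)$ = plays visiting $T$ at least once. The disjunctive query for $T_1,\dots,T_k$ asks for $\bigcup_i\langle\langle 1\rangle\rangle_{as}(P,\mathrm{Reach}(T_i))$. Orthogonal Vectors problem: given sets $S_1,S_2$ of $d$-bit vectors with $|S_i|\le N$ and $d\in\Theta(\log N)$, decide whether there are $u\in S_1,v\in S_2$ with $\sum_{i=1}^d u_iv_i=0$. Orthogonal Vectors Conjecture (OVC): there is no $O(N^{2-\epsilon})$ algorithm for this problem for any $\epsilon>0$ (it is implied by the Strong Exponential Time Hypothesis). *)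

theory Defs
  imports "HOL-Probability.Probability"
begin

section \<open>Markov decision processes\<close>

record 'v mdp =
  verts :: "'v set"
  edges :: "('v \<times> 'v) set"
  player1 :: "'v set"
  random :: "'v set"
  delta :: "'v \<Rightarrow> 'v pmf"

definition successors :: "'v mdp \<Rightarrow> 'v \<Rightarrow> 'v set" where
  "successors P v = {w. (v, w) \<in> edges P}"

text \<open>Every vertex has a successor, so that plays are infinite and a strategy can always move.\<close>

definition is_mdp :: "'v mdp \<Rightarrow> bool" where
  "is_mdp P \<longleftrightarrow>
     finite (verts P) \<and>
     edges P \<subseteq> verts P \<times> verts P \<and>
     player1 P \<union> random P = verts P \<and> player1 P \<inter> random P = {} \<and>
     (\<forall>v\<in>verts P. successors P v \<noteq> {}) \<and>
     (\<forall>v\<in>random P. set_pmf (delta P v) = successors P v)"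

definition path_prefix :: "'v mdp \<Rightarrow> 'v list \<Rightarrow> bool" where
  "path_prefix P h \<longleftrightarrow>
     h \<noteq> [] \<and> set h \<subseteq> verts P \<and> (\<forall>i. Suc i < length h \<longrightarrow> (h ! i, h ! Suc i) \<in> edges P)"

definition strategy :: "'v mdp \<Rightarrow> ('v list \<Rightarrow> 'v) \<Rightarrow> bool" where
  "strategy P \<sigma> \<longleftrightarrow>
     (\<forall>h. path_prefix P h \<and> last h \<in> player1 P \<longrightarrow> \<sigma> h \<in> successors P (last h))"

text \<open>Distribution of the next vertex of a play from \<open>v\<close>, given the vertices \<open>h\<close> visited so far.\<close>

definition next_vertex :: "'v mdp \<Rightarrow> ('v list \<Rightarrow> 'v) \<Rightarrow> 'v \<Rightarrow> 'v list \<Rightarrow> 'v pmf" where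
  "next_vertex P \<sigma> v h =
     (if h = [] then return_pmf v
      else if last h \<in> player1 P then return_pmf (\<sigma> h)
      else delta P (last h))"

definition step_kernel ::
    "'v mdp \<Rightarrow> ('v list \<Rightarrow> 'v) \<Rightarrow> 'v \<Rightarrow> nat \<Rightarrow> (nat \<Rightarrow> 'v) \<Rightarrow> 'v measure" where
  "step_kernel P \<sigma> v i \<omega> = measure_pmf (next_vertex P \<sigma> v (map \<omega> [0..<i]))"

lemma measurable_history:
  "(\<lambda>\<omega>. map \<omega> [0..<i]) \<in>
     measurable (PiM {0..<i} (\<lambda>_. count_space (UNIV :: 'v::countable set))) (count_space UNIV)"
  (is "?h \<in> measurable ?M _")
proof (rule measurableI)
  fix A :: "'v list set"
  have single: "?h -` {xs} \<inter> space ?M \<in> sets ?M" for xs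
  proof (cases "length xs = i")
    case True
    have "?h -` {xs} \<inter> space ?M = {\<omega> \<in> space ?M. \<forall>j\<in>{0..<i}. \<omega> j = xs ! j}"
      using True by (intro set_eqI iffI) (clarsimp simp: list_eq_iff_nth_eq)+
    also have "\<dots> \<in> sets ?M"
    proof (rule sets.sets_Collect_finite_All)
      fix j assume "j \<in> {0..<i}"
      then have "(\<lambda>\<omega>. \<omega> j) \<in> measurable ?M (count_space UNIV)"
        by (rule measurable_component_singleton)
      from measurable_sets[OF this, of "{xs ! j}"]
      show "{\<omega> \<in> space ?M. \<omega> j = xs ! j} \<in> sets ?M"
        by (simp add: vimage_def Int_def conj_commute)
    qed simp
    finally show ?thesis .
  next
    case False
    then have "?h -` {xs} \<inter> space ?M = {}"
      by (intro set_eqI iffI) (clarsimp simp: list_eq_iff_nth_eq)+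
    then show ?thesis
      by simp
  qed
  have "?h -` A \<inter> space ?M = (\<Union>xs\<in>A. ?h -` {xs} \<inter> space ?M)"
    by auto
  also have "\<dots> \<in> sets ?M"
    by (rule sets.countable_UN'') (auto intro: single)
  finally show "?h -` A \<inter> space ?M \<in> sets ?M" .
qed simp

lemma Ionescu_Tulcea_step_kernel:
  fixes P :: "'v::countable mdp"
  shows "Ionescu_Tulcea (step_kernel P \<sigma> v) (\<lambda>_. count_space UNIV)"
proof (rule Ionescu_Tulcea.intro)
  fix i
  have "(\<lambda>h. measure_pmf (next_vertex P \<sigma> v h)) \<in>
      measurable (count_space UNIV) (subprob_algebra (count_space UNIV))"
    by (simp add: space_subprob_algebra subprob_space_measure_pmf)
  from measurable_compose[OF measurable_history this]
  show "step_kernel P \<sigma> v i \<in>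
      measurable (PiM {0..<i} (\<lambda>_. count_space UNIV)) (subprob_algebra (count_space UNIV))"
    by (simp add: step_kernel_def[abs_def])
next
  fix i \<omega>
  show "prob_space (step_kernel P \<sigma> v i \<omega>)"
    unfolding step_kernel_def by (rule prob_space_measure_pmf)
qed

text \<open>
  The law on infinite vertex sequences given by the Ionescu-Tulcea theorem: the limit \<open>PF.lim\<close> of
  the locale above, whose finite-dimensional marginals are generated by the step kernels.
\<close>

definition play_measure ::
    "'v::countable mdp \<Rightarrow> ('v list \<Rightarrow> 'v) \<Rightarrow> 'v \<Rightarrow> (nat \<Rightarrow> 'v) measure" where
  "play_measure P \<sigma> v =
     projective_family.lim UNIV
       (Ionescu_Tulcea.CI (step_kernel P \<sigma> v) (\<lambda>_. count_space UNIV)) (\<lambda>_. count_space UNIV)"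

definition Reach :: "'v set \<Rightarrow> (nat \<Rightarrow> 'v) set" where
  "Reach T = {\<omega>. \<exists>i. \<omega> i \<in> T}"

definition almost_sure_winning :: "'v::countable mdp \<Rightarrow> (nat \<Rightarrow> 'v) set \<Rightarrow> 'v set" where
  "almost_sure_winning P \<psi> =
     {v \<in> verts P. \<exists>\<sigma>. strategy P \<sigma> \<and> measure (play_measure P \<sigma> v) \<psi> = 1}"

definition disjunctive_reach_query :: "'v::countable mdp \<Rightarrow> 'v set list \<Rightarrow> 'v set" where
  "disjunctive_reach_query P Ts = (\<Union>i<length Ts. almost_sure_winning P (Reach (Ts ! i)))"

section \<open>Word RAM programs\<close>

text \<open>
  Deterministic random access machine with unit-cost instructions, presented as a structured
  language. Registers and arrays are named by natural numbers; all cells hold natural numbers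
  below a word bound \<open>W\<close>, and an instruction whose result does not fit in a word has no execution.
\<close>

datatype binop = Add | Sub | Mul | Div | Mod | And | Or | Xor | Less | Eq

fun eval_binop :: "binop \<Rightarrow> nat \<Rightarrow> nat \<Rightarrow> nat" where
  "eval_binop Add a b = a + b"
| "eval_binop Sub a b = a - b"
| "eval_binop Mul a b = a * b"
| "eval_binop Div a b = a div b"
| "eval_binop Mod a b = a mod b"
| "eval_binop And a b = Bit_Operations.and a b"
| "eval_binop Or a b = Bit_Operations.or a b"
| "eval_binop Xor a b = Bit_Operations.xor a b"
| "eval_binop Less a b = of_bool (a < b)"
| "eval_binop Eq a b = of_bool (a = b)"

datatype cmd =
    Skip
  | Const nat nat            (* register, constant *)
  | Op binop nat nat nat     (* target register, argument registers *)
  | Load nat nat nat         (* target register, array, index register *)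
  | Store nat nat nat        (* array, index register, source register *)
  | Seq cmd cmd
  | If nat cmd cmd           (* a nonzero register counts as true *)
  | While nat cmd

record state =
  reg :: "nat \<Rightarrow> nat"
  arr :: "nat \<Rightarrow> nat \<Rightarrow> nat"

text \<open>\<open>exec W p s t s'\<close>: with word bound \<open>W\<close>, \<open>p\<close> started in \<open>s\<close> halts in \<open>s'\<close> after \<open>t\<close> steps.\<close>

inductive exec :: "nat \<Rightarrow> cmd \<Rightarrow> state \<Rightarrow> nat \<Rightarrow> state \<Rightarrow> bool" for W where
  exec_Skip: "exec W Skip s 1 s"
| exec_Const: "n < W \<Longrightarrow> exec W (Const x n) s 1 (s\<lparr>reg := (reg s)(x := n)\<rparr>)"
| exec_Op: "eval_binop f (reg s y) (reg s z) < W \<Longrightarrow>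
    exec W (Op f x y z) s 1 (s\<lparr>reg := (reg s)(x := eval_binop f (reg s y) (reg s z))\<rparr>)"
| exec_Load: "exec W (Load x a y) s 1 (s\<lparr>reg := (reg s)(x := arr s a (reg s y))\<rparr>)"
| exec_Store: "exec W (Store a y x) s 1
    (s\<lparr>arr := (arr s)(a := (arr s a)(reg s y := reg s x))\<rparr>)"
| exec_Seq: "exec W p s t s' \<Longrightarrow> exec W q s' u s'' \<Longrightarrow> exec W (Seq p q) s (t + u) s''"
| exec_If_true: "reg s x \<noteq> 0 \<Longrightarrow> exec W p s t s' \<Longrightarrow> exec W (If x p q) s (Suc t) s'"
| exec_If_false: "reg s x = 0 \<Longrightarrow> exec W q s t s' \<Longrightarrow> exec W (If x p q) s (Suc t) s'"
| exec_While_true: "reg s x \<noteq> 0 \<Longrightarrow> exec W p s t s' \<Longrightarrow> exec W (While x p) s' u s'' \<Longrightarrow>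
    exec W (While x p) s (Suc (t + u)) s''"
| exec_While_false: "reg s x = 0 \<Longrightarrow> exec W (While x p) s 1 s"

text \<open>The input is in array 0, the output is read off array 1; everything else is initially 0.\<close>

definition init_state :: "nat list \<Rightarrow> state" where
  "init_state xs =
     \<lparr>reg = (\<lambda>_. 0),
      arr = (\<lambda>a i. if a = 0 \<and> i < length xs then xs ! i else 0)\<rparr>"

text \<open>Words of \<open>O(log (input length + largest input number))\<close> bits.\<close>

definition word_bound :: "nat \<Rightarrow> nat list \<Rightarrow> nat" where
  "word_bound c xs = (c + length xs + Max (insert 0 (set xs))) ^ c"

record 'x problem =
  instances :: "'x set"
  encode :: "'x \<Rightarrow> nat list"
  correct :: "'x \<Rightarrow> (nat \<Rightarrow> nat) \<Rightarrow> bool"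

text \<open>\<open>Q\<close> has an algorithm with running time \<open>O(f)\<close>.\<close>

definition solvable_in_time :: "'x problem \<Rightarrow> ('x \<Rightarrow> real) \<Rightarrow> bool" where
  "solvable_in_time Q f \<longleftrightarrow>
     (\<exists>p c C. \<forall>x\<in>instances Q. \<exists>t s.
        exec (word_bound c (encode Q x)) p (init_state (encode Q x)) t s \<and>
        real t \<le> C * f x \<and>
        correct Q x (arr s 1))"

text \<open>
  The number \<open>k\<close> of target sets, hence the input length, is not bounded in terms of \<open>m\<close>. Granting
  time linear in the input length separates the hardness of a query from the cost of reading it.
\<close>

definition input_length :: "'x problem \<Rightarrow> 'x \<Rightarrow> real" where
  "input_length Q x = real (length (encode Q x))"

section \<open>The Orthogonal Vectors Conjecture\<close>

type_synonym ov_instance = "nat \<times> nat \<times> nat list list \<times> nat list list"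

definition ov_problem :: "real \<Rightarrow> real \<Rightarrow> ov_instance problem" where
  "ov_problem c\<^sub>1 c\<^sub>2 =
     \<lparr>instances = {(N, d, S\<^sub>1, S\<^sub>2).
        N \<ge> 2 \<and> c\<^sub>1 * log 2 (real N) \<le> real d \<and> real d \<le> c\<^sub>2 * log 2 (real N) \<and>
        distinct S\<^sub>1 \<and> distinct S\<^sub>2 \<and> length S\<^sub>1 \<le> N \<and> length S\<^sub>2 \<le> N \<and>
        (\<forall>u\<in>set S\<^sub>1 \<union> set S\<^sub>2. length u = d \<and> set u \<subseteq> {0, 1})},
      encode = (\<lambda>(N, d, S\<^sub>1, S\<^sub>2).
        [N, d, length S\<^sub>1, length S\<^sub>2] @ concat S\<^sub>1 @ concat S\<^sub>2),
      correct = (\<lambda>(N, d, S\<^sub>1, S\<^sub>2) out.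
        out 0 = of_bool (\<exists>u\<in>set S\<^sub>1. \<exists>v\<in>set S\<^sub>2. (\<Sum>i<d. u ! i * v ! i) = 0))\<rparr>"

text \<open>
  The constants hidden in \<open>d \<in> \<Theta>(log N)\<close> may depend on \<open>\<epsilon>\<close>. For fixed constants the problem does
  have an \<open>O(N\<^sup>2\<^sup>-\<^sup>\<epsilon>)\<close> algorithm for some \<open>\<epsilon> > 0\<close>, so the other order of quantifiers is refutable.
\<close>

definition OVC :: bool where
  "OVC \<longleftrightarrow>
     (\<forall>\<epsilon>>0. \<exists>c\<^sub>1 c\<^sub>2. 0 < c\<^sub>1 \<and> c\<^sub>1 \<le> c\<^sub>2 \<and>
        \<not> solvable_in_time (ov_problem c\<^sub>1 c\<^sub>2) (\<lambda>(N, d, S\<^sub>1, S\<^sub>2). real N powr (2 - \<epsilon>)))"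

section \<open>Disjunctive reachability queries as computational problems\<close>

record query =
  model :: "nat mdp"
  targets :: "nat set list"

abbreviation num_edges :: "query \<Rightarrow> real" where
  "num_edges q \<equiv> real (card (edges (model q)))"

abbreviation num_targets :: "query \<Rightarrow> real" where
  "num_targets q \<equiv> real (length (targets q))"

abbreviation winning_set :: "query \<Rightarrow> nat set" where
  "winning_set q \<equiv> disjunctive_reach_query (model q) (targets q)"

text \<open>
  Inputs have vertices \<open>0, \<dots>, n - 1\<close> and rational probabilities. Both parameters \<open>m\<close> and \<open>k\<close> are
  positive: otherwise the bounds \<open>m\<^sup>2\<^sup>-\<^sup>\<epsilon>\<close> and \<open>(k \<cdot> m)\<^sup>1\<^sup>-\<^sup>\<epsilon>\<close> would be 0 and unattainable.
\<close>

definition queries :: "query set" where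
  "queries = {q.
     is_mdp (model q) \<and>
     verts (model q) = {..<card (verts (model q))} \<and> verts (model q) \<noteq> {} \<and>
     (\<forall>v\<in>random (model q). \<forall>w. pmf (delta (model q) v) w \<in> \<rat>) \<and>
     targets q \<noteq> [] \<and> (\<forall>T\<in>set (targets q). T \<subseteq> verts (model q))}"

text \<open>Numerator and denominator, in lowest terms.\<close>

definition encode_prob :: "real \<Rightarrow> nat list" where
  "encode_prob x = (case quotient_of (THE r. of_rat r = x) of (a, b) \<Rightarrow> [nat a, nat b])"

definition encode_vertex :: "nat mdp \<Rightarrow> nat \<Rightarrow> nat list" where
  "encode_vertex P v =
     [of_bool (v \<in> player1 P), card (successors P v)] @
     concat (map (\<lambda>w. w # (if v \<in> random P then encode_prob (pmf (delta P v) w) else []))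
       (sorted_list_of_set (successors P v)))"

definition encode_query :: "query \<Rightarrow> nat list" where
  "encode_query q =
     card (verts (model q)) #
     concat (map (encode_vertex (model q)) [0..<card (verts (model q))]) @
     length (targets q) #
     concat (map (\<lambda>T. card T # sorted_list_of_set T) (targets q))"

text \<open>The computed set is output as its characteristic vector.\<close>

definition winning_set_problem :: "query problem" where
  "winning_set_problem =
     \<lparr>instances = queries, encode = encode_query,
      correct = (\<lambda>q out. \<forall>v\<in>verts (model q). out v = of_bool (v \<in> winning_set q))\<rparr>"

text \<open>
  Targets are winning, so the winning set is nonempty iff some target set is. This takes only linear
  time in the length of the input, which however is not bounded in terms of \<open>m\<close>, nor by a power
  of \<open>k \<cdot> m\<close> with exponent below 1.
\<close>

definition nonempty_problem :: "query problem" where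
  "nonempty_problem =
     \<lparr>instances = queries, encode = encode_query,
      correct = (\<lambda>q out. out 0 = of_bool (winning_set q \<noteq> {}))\<rparr>"

definition membership_problem :: "(query \<times> nat) problem" where
  "membership_problem =
     \<lparr>instances = {(q, v). q \<in> queries \<and> v \<in> verts (model q)},
      encode = (\<lambda>(q, v). v # encode_query q),
      correct = (\<lambda>(q, v) out. out 0 = of_bool (v \<in> winning_set q))\<rparr>"

end

theory Submission
  imports Defs
begin

text \<open>
  An instance \<open>(U, V)\<close> of Orthogonal Vectors in dimension \<open>d\<close> becomes an MDP in which player 1 first
  picks a vector \<open>u \<in> U\<close>, then a coordinate \<open>i\<close> is drawn uniformly, and if \<open>u\<^sub>i = 0\<close> player 1
  picks a bit for \<open>i\<close>, whereas \<open>u\<^sub>i = 1\<close> forces the bit 0. The target of \<open>v \<in> V\<close> asks for the bit \<open>v\<^sub>i\<close>,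
  so it is reached almost surely from the start iff some \<open>u\<close> is orthogonal to \<open>v\<close>. This query has
  \<open>O(N d)\<close> edges, \<open>O(N)\<close> targets and an encoding which is computed in time \<open>O(N d)\<close>; as \<open>d = O(log N)\<close>,
  the factor \<open>d\<close> is absorbed by halving \<open>\<epsilon>\<close>.

  Non-emptiness of the winning set needs no conjecture: in the MDP with a single vertex and \<open>k\<close> target
  sets, all empty or all but one, an algorithm has to read all \<open>k\<close> targets, while \<open>m = 1\<close>.
\<close>

section \<open>The law of a play\<close>

text \<open>The query realises a nest of quantifiers. The disjunction fixes \<open>v\<close> before
  any strategy is chosen, so the strategy may depend on \<open>v\<close>; its deterministic first
  move picks \<open>u\<close>; and the uniform draw gives every coordinate positive probability, so
  all of them must succeed. Hence no probability has to be computed: winning is proved by following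
  an arbitrary consistent play, and refuted by one finite prefix of positive probability that ends
  in a trap. The same query says nothing about non-emptiness, because every vertex of a target
  already wins. On the machine side, the query algorithm is an arbitrary \<open>cmd\<close> that
  expects a fresh memory and the word bound of the query's code. It is therefore renamed away from
  the cells of the reduction, and the constant in the word bound is enlarged to absorb the linear
  growth of the code. For the exponents, the conjecture is used at \<open>\<epsilon> / 2\<close> and
  \<open>d\<close> is bounded by a multiple of \<open>N powr (\<epsilon> / 4)\<close>: then
  \<open>m powr (2 - \<epsilon>)\<close> has exponent \<open>(1 + \<epsilon> / 4) * (2 - \<epsilon>)
  = 2 - \<epsilon> / 2 - \<epsilon>^2 / 4\<close> in \<open>N\<close>.\<close>

context
  fixes P :: "'v::countable mdp" and \<sigma> :: "'v list \<Rightarrow> 'v" and v :: 'v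
begin

interpretation IT: Ionescu_Tulcea "step_kernel P \<sigma> v" "\<lambda>_. count_space UNIV"
  by (rule Ionescu_Tulcea_step_kernel)

lemma sets_play_measure [measurable_cong]:
  "sets (play_measure P \<sigma> v) = sets (PiM UNIV (\<lambda>_. count_space UNIV))"
  unfolding play_measure_def by (rule IT.PF.sets_lim)

lemma space_play_measure [simp]: "space (play_measure P \<sigma> v) = UNIV"
  using sets_eq_imp_space_eq[OF sets_play_measure] by (simp add: space_PiM)

lemma prefix_event_in_sets:
  "{\<omega> \<in> space (PiM {0..<n} (\<lambda>_. count_space UNIV)). map \<omega> [0..<n] = h}
     \<in> sets (PiM {0..<n} (\<lambda>_. count_space (UNIV :: 'v set)))"
  using measurable_sets[OF measurable_history, of "{h}" n]
  by (simp add: vimage_def Int_def conj_commute)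

text \<open>The event depends on the first \<open>n\<close> vertices only, so the limit measure can
  be evaluated through its finite marginal \<open>IT.C 0 n\<close>.\<close>

lemma emeasure_play_measure_prefix:
  "emeasure (play_measure P \<sigma> v) {\<omega>. map \<omega> [0..<n] = h} =
     emeasure (IT.C 0 n (\<lambda>_. undefined))
       {\<omega> \<in> space (PiM {0..<n} (\<lambda>_. count_space UNIV)). map \<omega> [0..<n] = h}"
    (is "_ = emeasure _ ?X")
proof -
  have "map (restrict \<omega> {0..<n}) [0..<n] = map \<omega> [0..<n]" for \<omega> :: "nat \<Rightarrow> 'v"
    by simp
  then have "{\<omega>. map \<omega> [0..<n] = h} = IT.PF.emb UNIV {0..<n} ?X"
    by (auto simp: prod_emb_def space_PiM PiE_iff)
  then have "emeasure (play_measure P \<sigma> v) {\<omega>. map \<omega> [0..<n] = h} = IT.CI {0..<n} ?X"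
    unfolding play_measure_def by (simp only: IT.lim[OF finite_atLeastLessThan prefix_event_in_sets])
  also have "\<dots> = IT.C 0 n (\<lambda>_. undefined) (IT.PF.emb {0..<n} {0..<n} ?X)"
    by (rule IT.emeasure_CI[OF subset_refl prefix_event_in_sets])
  also have "IT.PF.emb {0..<n} {0..<n} ?X = ?X"
    by (rule prod_emb_id) (auto simp: space_PiM)
  finally show ?thesis .
qed

text \<open>\<open>IT.C 0 (Suc n)\<close> binds \<open>IT.C 0 n\<close> with the kernel of step
  \<open>n\<close>, and on histories equal to \<open>h\<close> this kernel is the fixed distribution
  \<open>next_vertex P \<sigma> v h\<close>. Iterated, the probability of a prefix is the product of
  its step probabilities.\<close>

lemma emeasure_play_measure_prefix_snoc:
  assumes "length h = n"
  shows "emeasure (play_measure P \<sigma> v) {\<omega>. map \<omega> [0..<Suc n] = h @ [w]} =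
    ennreal (pmf (next_vertex P \<sigma> v h) w) * emeasure (play_measure P \<sigma> v) {\<omega>. map \<omega> [0..<n] = h}"
proof -
  let ?M = "\<lambda>n. PiM {0..<n} (\<lambda>_. count_space (UNIV :: 'v set))"
  let ?X = "\<lambda>n h. {\<omega> \<in> space (?M n). map \<omega> [0..<n] = h}"
  let ?C = "IT.C 0 n (\<lambda>_. undefined)"
  let ?p = "ennreal (pmf (next_vertex P \<sigma> v h) w)"
  have u: "(\<lambda>_. undefined) \<in> space (?M 0)"
    by (simp add: space_PiM PiE_iff extensional_def)
  have "emeasure (IT.C 0 (Suc n) (\<lambda>_. undefined)) (?X (Suc n) (h @ [w])) =
      (\<integral>\<^sup>+ \<omega>. emeasure (IT.eP n \<omega>) (?X (Suc n) (h @ [w])) \<partial>?C)"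
    unfolding IT.C.simps add_0_left
    using IT.measurable_eP[of n] prob_space.not_empty[OF IT.prob_space_C[OF u, of n]]
    by (intro emeasure_bind[OF _ _ prefix_event_in_sets])
       (auto simp: measurable_cong_sets[OF IT.sets_C[OF u] refl])
  also have "\<dots> = (\<integral>\<^sup>+ \<omega>. ?p * indicator (?X n h) \<omega> \<partial>?C)"
  proof (rule nn_integral_cong)
    fix \<omega> assume "\<omega> \<in> space ?C"
    then have \<omega>: "\<omega> \<in> space (?M n)"
      using IT.space_C[OF u, of n] by simp
    have "emeasure (IT.eP n \<omega>) (?X (Suc n) (h @ [w])) =
       emeasure (step_kernel P \<sigma> v n \<omega>) ((\<lambda>x. fun_upd \<omega> n x) -` ?X (Suc n) (h @ [w]))"
      by (subst IT.emeasure_eP[OF \<omega> prefix_event_in_sets]) simp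
    also have "(\<lambda>x. fun_upd \<omega> n x) -` ?X (Suc n) (h @ [w]) = (if map \<omega> [0..<n] = h then {w} else {})"
      using \<omega> by (auto simp: space_PiM PiE_iff extensional_def)
    also have "emeasure (step_kernel P \<sigma> v n \<omega>) \<dots> = ?p * indicator (?X n h) \<omega>"
      using \<omega> by (auto simp: step_kernel_def emeasure_pmf_single)
    finally show "emeasure (IT.eP n \<omega>) (?X (Suc n) (h @ [w])) = ?p * indicator (?X n h) \<omega>" .
  qed
  also have "\<dots> = ?p * emeasure ?C (?X n h)"
    using prefix_event_in_sets IT.sets_C[OF u, of n] by (intro nn_integral_cmult_indicator) simp
  finally show ?thesis
    unfolding emeasure_play_measure_prefix .
qed

lemma prefix_event_in_play_sets [measurable]:
  "{\<omega>. map \<omega> [0..<n] = h} \<in> sets (play_measure P \<sigma> v)"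
proof -
  have "map (restrict \<omega> {0..<n}) [0..<n] = map \<omega> [0..<n]" for \<omega> :: "nat \<Rightarrow> 'v"
    by simp
  then have "{\<omega>. map \<omega> [0..<n] = h} = IT.PF.emb UNIV {0..<n}
      {\<omega> \<in> space (PiM {0..<n} (\<lambda>_. count_space UNIV)). map \<omega> [0..<n] = h}"
    by (auto simp: prod_emb_def space_PiM PiE_iff)
  then show ?thesis
    using sets_PiM_I[of "{0..<n}" UNIV] prefix_event_in_sets
    by (simp add: sets_play_measure measurable_prod_emb)
qed

lemma prob_space_play_measure: "prob_space (play_measure P \<sigma> v)"
proof
  have u: "(\<lambda>_. undefined) \<in> space (PiM {0..<0} (\<lambda>_. count_space (UNIV :: 'v set)))"
    by (simp add: space_PiM PiE_iff extensional_def)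
  have "emeasure (play_measure P \<sigma> v) {\<omega>. map \<omega> [0..<0] = []} = 1"
    unfolding emeasure_play_measure_prefix
    using prob_space.emeasure_space_1[OF IT.prob_space_C[OF u, of 0]] IT.space_C[OF u, of 0]
    by simp
  then show "emeasure (play_measure P \<sigma> v) (space (play_measure P \<sigma> v)) = 1"
    by simp
qed

text \<open>There are only countably many finite histories, so the histories with an impossible last
  step form a countable union of null sets. An almost sure claim may thus be proved for one
  arbitrary consistent play.\<close>

lemma AE_play_measure_support:
  "AE \<omega> in play_measure P \<sigma> v. \<forall>n. \<omega> n \<in> set_pmf (next_vertex P \<sigma> v (map \<omega> [0..<n]))"
proof (subst AE_all_countable, intro allI)
  fix n
  let ?B = "{(h, w). length h = n \<and> w \<notin> set_pmf (next_vertex P \<sigma> v h)}"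
  have "(\<Union>(h, w)\<in>?B. {\<omega>. map \<omega> [0..<Suc n] = h @ [w]}) \<in> null_sets (play_measure P \<sigma> v)"
  proof (rule null_sets_UN')
    show "countable ?B"
      by (rule countableI_type)
    fix b assume "b \<in> ?B"
    then show "(case b of (h, w) \<Rightarrow> {\<omega>. map \<omega> [0..<Suc n] = h @ [w]}) \<in> null_sets (play_measure P \<sigma> v)"
      using prefix_event_in_play_sets[of "Suc n"]
      by (cases b)
         (auto simp: null_sets_def set_pmf_iff emeasure_play_measure_prefix_snoc
            simp del: upt_Suc)
  qed
  then show "AE \<omega> in play_measure P \<sigma> v. \<omega> n \<in> set_pmf (next_vertex P \<sigma> v (map \<omega> [0..<n]))"
    by (rule AE_I') auto
qed

section \<open>Almost sure reachability and possible prefixes\<close>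

lemma Reach_in_play_sets [measurable]: "Reach T \<in> sets (play_measure P \<sigma> v)"
proof -
  have "(\<lambda>\<omega>. \<omega> i) \<in> measurable (play_measure P \<sigma> v) (count_space UNIV)" for i
    unfolding measurable_cong_sets[OF sets_play_measure refl]
    by (rule measurable_component_singleton) simp
  then have "(\<lambda>\<omega>. \<omega> i) -` T \<inter> space (play_measure P \<sigma> v) \<in> sets (play_measure P \<sigma> v)" for i
    by (rule measurable_sets) simp
  moreover have "Reach T = (\<Union>i. (\<lambda>\<omega>. \<omega> i) -` T \<inter> space (play_measure P \<sigma> v))"
    by (auto simp: Reach_def)
  ultimately show ?thesis
    by simp
qed

lemma measure_Reach_eq_1_iff:
  "measure (play_measure P \<sigma> v) (Reach T) = 1 \<longleftrightarrow> (AE \<omega> in play_measure P \<sigma> v. \<exists>i. \<omega> i \<in> T)"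
proof -
  interpret prob_space "play_measure P \<sigma> v"
    by (rule prob_space_play_measure)
  show ?thesis
    using AE_in_set_eq_1[OF Reach_in_play_sets] by (simp add: Reach_def)
qed

lemma emeasure_prefix_pos:
  assumes "\<And>i. i < length h \<Longrightarrow> h ! i \<in> set_pmf (next_vertex P \<sigma> v (take i h))"
  shows "emeasure (play_measure P \<sigma> v) {\<omega>. map \<omega> [0..<length h] = h} > 0"
  using assms
proof (induction h rule: rev_induct)
  case Nil
  interpret prob_space "play_measure P \<sigma> v"
    by (rule prob_space_play_measure)
  show ?case
    using emeasure_space_1 by simp
next
  case (snoc w h)
  have "h ! i \<in> set_pmf (next_vertex P \<sigma> v (take i h))" if "i < length h" for i
    using snoc.prems[of i] that by (simp add: nth_append)
  moreover have "pmf (next_vertex P \<sigma> v h) w > 0"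
    using snoc.prems[of "length h"] by (simp add: pmf_positive)
  ultimately show ?case
    using snoc.IH emeasure_play_measure_prefix_snoc[of h "length h" w]
    by (simp add: ennreal_zero_less_mult_iff del: upt_Suc)
qed

text \<open>A prefix with possible steps has positive probability, so an almost sure event cannot
  avoid it. This is the tool for refuting a strategy: exhibit a possible prefix after which no
  consistent play meets \<open>T\<close>.\<close>

lemma measure_Reach_eq_1_prefix:
  assumes "measure (play_measure P \<sigma> v) (Reach T) = 1"
    and "\<And>i. i < length h \<Longrightarrow> h ! i \<in> set_pmf (next_vertex P \<sigma> v (take i h))"
  obtains \<omega> i where "map \<omega> [0..<length h] = h" "\<omega> i \<in> T"
    "\<And>n. \<omega> n \<in> set_pmf (next_vertex P \<sigma> v (map \<omega> [0..<n]))"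
proof -
  have "\<not> (AE \<omega> in play_measure P \<sigma> v. map \<omega> [0..<length h] \<noteq> h)"
  proof
    assume "AE \<omega> in play_measure P \<sigma> v. map \<omega> [0..<length h] \<noteq> h"
    then have "emeasure (play_measure P \<sigma> v) {\<omega>. map \<omega> [0..<length h] = h} = 0"
      by (subst (asm) AE_iff_measurable[OF prefix_event_in_play_sets]) auto
    with emeasure_prefix_pos[OF assms(2)] show False
      by simp
  qed
  moreover have "AE \<omega> in play_measure P \<sigma> v. \<exists>i. \<omega> i \<in> T"
    using assms(1) by (simp add: measure_Reach_eq_1_iff)
  ultimately have "\<exists>\<omega>. map \<omega> [0..<length h] = h \<and> (\<exists>i. \<omega> i \<in> T) \<and>
      (\<forall>n. \<omega> n \<in> set_pmf (next_vertex P \<sigma> v (map \<omega> [0..<n])))"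
    using AE_play_measure_support by (smt (verit) eventually_mono eventually_elim2)
  with that show ?thesis
    by blast
qed

end

section \<open>Consistent plays are infinite paths\<close>

lemma next_vertex_Suc:
  "next_vertex P \<sigma> v (map \<omega> [0..<Suc n]) =
     (if \<omega> n \<in> player1 P then return_pmf (\<sigma> (map \<omega> [0..<Suc n])) else delta P (\<omega> n))"
  by (simp add: next_vertex_def)

lemma consistent_play_edge:
  assumes "is_mdp P" "strategy P \<sigma>" "v \<in> verts P"
    and consistent: "\<And>n. \<omega> n \<in> set_pmf (next_vertex P \<sigma> v (map \<omega> [0..<n]))"
  shows "(\<omega> n, \<omega> (Suc n)) \<in> edges P"
proof -
  have E: "edges P \<subseteq> verts P \<times> verts P" and part: "player1 P \<union> random P = verts P"
    and delta: "\<And>v. v \<in> random P \<Longrightarrow> set_pmf (delta P v) = successors P v"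
    using assms(1) by (auto simp: is_mdp_def)
  have "\<omega> 0 = v"
    using consistent[of 0] by (simp add: next_vertex_def)
  \<comment> \<open>\<open>strategy\<close> restricts \<open>\<sigma>\<close> on path prefixes only,
    so the induction has to show along the way that the history is one.\<close>
  have "path_prefix P (map \<omega> [0..<Suc n]) \<and> (\<omega> n, \<omega> (Suc n)) \<in> edges P" for n
  proof (induction n)
    case 0
    have "path_prefix P (map \<omega> [0..<Suc 0])"
      using \<open>\<omega> 0 = v\<close> assms(3) by (simp add: path_prefix_def)
    then show ?case
      using consistent[of "Suc 0"] assms(2,3) \<open>\<omega> 0 = v\<close> delta[of v] part
      by (auto simp: next_vertex_def strategy_def successors_def split: if_splits)
  next
    case (Suc n)
    have "(map \<omega> [0..<Suc (Suc n)] ! i, map \<omega> [0..<Suc (Suc n)] ! Suc i) \<in> edges P"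
      if "Suc i < Suc (Suc n)" for i
    proof (cases "i = n")
      case True
      then show ?thesis
        using Suc by (simp del: upt_Suc)
    next
      case False
      then have "Suc i < length (map \<omega> [0..<Suc n])"
        using that by simp
      then have "(map \<omega> [0..<Suc n] ! i, map \<omega> [0..<Suc n] ! Suc i) \<in> edges P"
        using Suc unfolding path_prefix_def by blast
      then show ?thesis
        using False that by (simp del: upt_Suc)
    qed
    moreover have "\<omega> (Suc n) \<in> verts P"
      using Suc E by auto
    ultimately have *: "path_prefix P (map \<omega> [0..<Suc (Suc n)])"
      using Suc by (auto simp: path_prefix_def simp del: upt_Suc) (auto simp: less_Suc_eq)
    have "\<omega> (Suc (Suc n)) \<in> successors P (\<omega> (Suc n))"
    proof (cases "\<omega> (Suc n) \<in> player1 P")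
      case True
      with * assms(2) have "\<sigma> (map \<omega> [0..<Suc (Suc n)]) \<in> successors P (\<omega> (Suc n))"
        unfolding strategy_def by force
      with True consistent[of "Suc (Suc n)"] show ?thesis
        by (simp add: next_vertex_Suc del: upt_Suc)
    next
      case False
      with \<open>\<omega> (Suc n) \<in> verts P\<close> part have "\<omega> (Suc n) \<in> random P"
        by auto
      with False consistent[of "Suc (Suc n)"] delta show ?thesis
        by (simp add: next_vertex_Suc del: upt_Suc)
    qed
    with * show ?case
      by (simp add: successors_def)
  qed
  then show ?thesis
    by simp
qed

lemma consistent_play_absorbing:
  assumes "is_mdp P" "strategy P \<sigma>" "v \<in> verts P"
    and "\<And>n. \<omega> n \<in> set_pmf (next_vertex P \<sigma> v (map \<omega> [0..<n]))"
    and "successors P x = {x}" "\<omega> m = x" "m \<le> n"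
  shows "\<omega> n = x"
  using \<open>m \<le> n\<close>
proof (induction rule: dec_induct)
  case base
  then show ?case by (simp add: assms(6))
next
  case (step n)
  then show ?case
    using consistent_play_edge[OF assms(1-4), of n] assms(5) by (auto simp: successors_def)
qed

section \<open>From orthogonal vectors to a disjunctive query\<close>

text \<open>
  The vertices of the reduction: for each coordinate \<open>i\<close> a choice vertex \<open>3i\<close> with successors
  \<open>3i + 1\<close> and \<open>3i + 2\<close>, both absorbing; the start vertex \<open>3d\<close>; an absorbing vertex \<open>3d + 1\<close>, which
  gives the start vertex a successor if \<open>U\<close> is empty; and for the \<open>j\<close>-th vector \<open>u\<close> of \<open>U\<close> a random
  vertex \<open>3d + 2 + j\<close> with successors \<open>3i + u\<^sub>i\<close>. The target of \<open>v\<close> consists of all \<open>3i + 1 + v\<^sub>i\<close>, so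
  that coordinate \<open>i\<close> misses it iff \<open>u\<^sub>i = v\<^sub>i = 1\<close>.
\<close>

definition ov_succ :: "nat \<Rightarrow> nat list list \<Rightarrow> nat \<Rightarrow> nat set" where
  "ov_succ d U x =
     (if x < 3 * d then (if x mod 3 = 0 then {x + 1, x + 2} else {x})
      else if x = 3 * d then {3 * d + 1..<3 * d + 2 + length U}
      else if x = 3 * d + 1 then {x}
      else (\<lambda>i. 3 * i + U ! (x - (3 * d + 2)) ! i) ` {..<d})"

definition ov_mdp :: "nat \<Rightarrow> nat list list \<Rightarrow> nat mdp" where
  "ov_mdp d U =
     \<lparr>verts = {..<3 * d + 2 + length U},
      edges = (SIGMA x:{..<3 * d + 2 + length U}. ov_succ d U x),
      player1 = {..<3 * d + 2},
      random = {3 * d + 2..<3 * d + 2 + length U},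
      delta = (\<lambda>x. pmf_of_set (ov_succ d U x))\<rparr>"

definition ov_target :: "nat \<Rightarrow> nat list \<Rightarrow> nat set" where
  "ov_target d v = (\<lambda>i. 3 * i + 1 + v ! i) ` {..<d}"

text \<open>The empty target set makes the list of targets nonempty even if \<open>V\<close> is empty.\<close>

definition ov_query :: "nat \<Rightarrow> nat list list \<Rightarrow> nat list list \<Rightarrow> query" where
  "ov_query d U V = \<lparr>model = ov_mdp d U, targets = map (ov_target d) V @ [{}]\<rparr>"

lemma ov_mdp_simps [simp]:
  "verts (ov_mdp d U) = {..<3 * d + 2 + length U}"
  "edges (ov_mdp d U) = (SIGMA x:{..<3 * d + 2 + length U}. ov_succ d U x)"
  "player1 (ov_mdp d U) = {..<3 * d + 2}"
  "random (ov_mdp d U) = {3 * d + 2..<3 * d + 2 + length U}"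
  "delta (ov_mdp d U) x = pmf_of_set (ov_succ d U x)"
  by (simp_all add: ov_mdp_def)

lemma ov_query_simps [simp]:
  "model (ov_query d U V) = ov_mdp d U"
  "targets (ov_query d U V) = map (ov_target d) V @ [{}]"
  by (simp_all add: ov_query_def)

lemma successors_ov_mdp [simp]:
  "x < 3 * d + 2 + length U \<Longrightarrow> successors (ov_mdp d U) x = ov_succ d U x"
  by (auto simp: successors_def)

lemma finite_ov_succ [simp]: "finite (ov_succ d U x)"
  by (simp add: ov_succ_def)

text \<open>The encoding lists successors and targets in increasing order. Both families are images
  of maps such as \<open>3 * i + b i\<close> with bits \<open>b i\<close>, which increase strictly
  with \<open>i\<close>, so the program can write them coordinate by coordinate without
  sorting.\<close>

lemma sorted_list_of_set_image_strict_mono: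
  fixes f :: "nat \<Rightarrow> nat"
  assumes "\<And>i j. i < j \<Longrightarrow> j < d \<Longrightarrow> f i < f j"
  shows "sorted_list_of_set (f ` {..<d}) = map f [0..<d]" "card (f ` {..<d}) = d"
proof -
  have "sorted_wrt (<) (map f [0..<d])"
    using assms by (auto simp: sorted_wrt_iff_nth_less)
  then have *: "sorted (map f [0..<d])" "distinct (map f [0..<d])"
    using strict_sorted_iff by blast+
  have set: "set (map f [0..<d]) = f ` {..<d}"
    by (simp add: lessThan_atLeast0)
  show "sorted_list_of_set (f ` {..<d}) = map f [0..<d]"
    using sorted_list_of_set.idem_if_sorted_distinct[OF *] by (simp only: set)
  show "card (f ` {..<d}) = d"
    using distinct_card[OF *(2)] by (simp only: set length_map length_upt)
qed

locale ov_reduction =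
  fixes d :: nat and U V :: "nat list list"
  assumes d_pos: "0 < d"
    and vectors: "\<And>u. u \<in> set U \<union> set V \<Longrightarrow> length u = d \<and> set u \<subseteq> {0, 1}"
begin

lemma coord_le_1:
  "u \<in> set U \<Longrightarrow> i < d \<Longrightarrow> u ! i \<le> 1" "u \<in> set V \<Longrightarrow> i < d \<Longrightarrow> u ! i \<le> 1"
proof -
  have "u ! i \<le> 1" if "u \<in> set U \<union> set V" "i < d" for u i
  proof -
    have "u ! i \<in> {0, 1}"
      using vectors[OF that(1)] that(2) nth_mem[of i u] by blast
    then show ?thesis by auto
  qed
  then show "u \<in> set U \<Longrightarrow> i < d \<Longrightarrow> u ! i \<le> 1" "u \<in> set V \<Longrightarrow> i < d \<Longrightarrow> u ! i \<le> 1"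
    by auto
qed

lemma coord_vertex_less:
  assumes "i < d" "b \<le> (2 :: nat)"
  shows "3 * i + b < 3 * d"
  using assms by linarith

lemma ov_succ_vector:
  "ov_succ d U (3 * d + 2 + j) = (\<lambda>i. 3 * i + U ! j ! i) ` {..<d}"
  by (simp add: ov_succ_def)

lemma ov_succ_subset:
  assumes "x < 3 * d + 2 + length U"
  shows "ov_succ d U x \<subseteq> {..<3 * d + 2 + length U}"
proof (cases "x < 3 * d + 2")
  case True
  have "x + 2 < 3 * d" if "x < 3 * d" "x mod 3 = 0"
    using that by presburger
  with True show ?thesis
    by (auto simp: ov_succ_def)
next
  case False
  then obtain j where j: "x = 3 * d + 2 + j"
    using le_Suc_ex[of "3 * d + 2" x] by auto
  with assms have "j < length U"
    by simp
  then have "3 * i + U ! j ! i < 3 * d" if "i < d" for i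
    using that coord_le_1(1)[of "U ! j" i] coord_vertex_less[of i "U ! j ! i"] by simp
  then show ?thesis
    unfolding j ov_succ_vector by force
qed

lemma ov_succ_nonempty: "ov_succ d U x \<noteq> {}"
  using d_pos by (auto simp: ov_succ_def)

lemma is_mdp_ov_mdp: "is_mdp (ov_mdp d U)"
  using ov_succ_subset ov_succ_nonempty
  by (auto simp: is_mdp_def set_pmf_of_set)

lemma ov_target_less: "v \<in> set V \<Longrightarrow> x \<in> ov_target d v \<Longrightarrow> x < 3 * d"
  using coord_le_1(2)[of v] coord_vertex_less by (fastforce simp: ov_target_def)

lemma ov_query_in_queries: "ov_query d U V \<in> queries"
proof -
  have "pmf (pmf_of_set (ov_succ d U x)) w \<in> \<rat>" for x w
    using ov_succ_nonempty by (simp add: pmf_of_set indicator_def)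
  then show ?thesis
    using is_mdp_ov_mdp ov_target_less by (fastforce simp: queries_def)
qed

text \<open>After the draw of \<open>i\<close> the play is at \<open>3 * i + u ! i\<close>. If
  \<open>u ! i = 1\<close>, orthogonality gives \<open>v ! i = 0\<close> and this vertex is already
  a target; otherwise it is the choice vertex and the next move goes to the target
  \<open>3 * i + 1 + v ! i\<close>.\<close>

lemma start_winning_if_orthogonal:
  assumes "u \<in> set U" "v \<in> set V" and orth: "\<And>i. i < d \<Longrightarrow> u ! i * v ! i = 0"
  shows "3 * d \<in> winning_set (ov_query d U V)"
proof -
  obtain j where j: "j < length U" "U ! j = u"
    using assms(1) by (auto simp: in_set_conv_nth)
  obtain l where l: "l < length V" "V ! l = v"
    using assms(2) by (auto simp: in_set_conv_nth)
  let ?P = "ov_mdp d U"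
  \<comment> \<open>A memoryless strategy; \<open>x div 3\<close> recovers the coordinate. The
    remaining branches return \<open>x\<close> on the absorbing vertices, since a strategy must be
    legal on all path prefixes and not only on those of the play.\<close>
  define \<sigma> where "\<sigma> h =
    (let x = last h in
     if x < 3 * d then (if x mod 3 = 0 then x + 1 + v ! (x div 3) else x)
     else if x = 3 * d then 3 * d + 2 + j else x)" for h
  have v_le: "x + 1 + v ! (x div 3) \<in> {x + 1, x + 2}" if "x < 3 * d" for x
  proof -
    have "x div 3 < d"
      using that by (simp add: less_mult_imp_div_less mult.commute)
    then show ?thesis
      using coord_le_1(2)[OF assms(2), of "x div 3"] by (auto simp: le_Suc_eq)
  qed
  have "strategy ?P \<sigma>"
    unfolding strategy_def
  proof (intro allI impI)
    fix h assume "path_prefix ?P h \<and> last h \<in> player1 ?P"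
    then have "last h < 3 * d + 2"
      by simp
    then show "\<sigma> h \<in> successors ?P (last h)"
      using v_le[of "last h"] j(1) by (auto simp: \<sigma>_def Let_def ov_succ_def)
  qed
  moreover have "measure (play_measure ?P \<sigma> (3 * d)) (Reach (ov_target d v)) = 1"
    unfolding measure_Reach_eq_1_iff
    using AE_play_measure_support[of ?P \<sigma> "3 * d"]
  proof (rule eventually_mono)
    fix \<omega> assume consistent: "\<forall>n. \<omega> n \<in> set_pmf (next_vertex ?P \<sigma> (3 * d) (map \<omega> [0..<n]))"
    have "\<omega> 0 = 3 * d"
      using consistent[rule_format, of 0] by (simp add: next_vertex_def)
    then have 1: "\<omega> (Suc 0) = 3 * d + 2 + j"
      using consistent[rule_format, of "Suc 0"] by (simp add: next_vertex_def \<sigma>_def)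
    have "\<omega> (Suc (Suc 0)) \<in> set_pmf (pmf_of_set (ov_succ d U (3 * d + 2 + j)))"
      using consistent[rule_format, of "Suc (Suc 0)"] 1 by (simp add: next_vertex_Suc del: upt_Suc)
    then have "\<omega> (Suc (Suc 0)) \<in> ov_succ d U (3 * d + 2 + j)"
      using ov_succ_nonempty by (simp add: set_pmf_of_set)
    then obtain i where i: "i < d" and 2: "\<omega> (Suc (Suc 0)) = 3 * i + u ! i"
      unfolding ov_succ_vector j(2) by auto
    show "\<exists>n. \<omega> n \<in> ov_target d v"
    proof (cases "u ! i = 0")
      case True
      have "\<omega> (Suc (Suc (Suc 0))) = 3 * i + 1 + v ! i"
        using consistent[rule_format, of "Suc (Suc (Suc 0))"] 2 True i
        by (simp add: next_vertex_def \<sigma>_def)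
      with i show ?thesis
        by (auto simp: ov_target_def)
    next
      case False
      then have "u ! i = 1" "v ! i = 0"
        using coord_le_1(1)[OF assms(1) i] orth[OF i] by auto
      with i 2 have "\<omega> (Suc (Suc 0)) \<in> ov_target d v"
        unfolding ov_target_def by (intro image_eqI[of _ _ i]) auto
      then show ?thesis
        by blast
    qed
  qed
  ultimately have "3 * d \<in> almost_sure_winning ?P (Reach (targets (ov_query d U V) ! l))"
    using l by (auto simp: almost_sure_winning_def nth_append)
  then show ?thesis
    unfolding disjunctive_reach_query_def using l(1) by (auto simp del: ov_query_simps(2)) force
qed

lemma orthogonal_if_start_winning:
  assumes "3 * d \<in> winning_set (ov_query d U V)"
  obtains u v where "u \<in> set U" "v \<in> set V" "\<And>i. i < d \<Longrightarrow> u ! i * v ! i = 0"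
proof -
  let ?P = "ov_mdp d U"
  from assms obtain l \<sigma> where l: "l < Suc (length V)" and \<sigma>: "strategy ?P \<sigma>"
    and win: "measure (play_measure ?P \<sigma> (3 * d)) (Reach (targets (ov_query d U V) ! l)) = 1"
    by (auto simp: disjunctive_reach_query_def almost_sure_winning_def)
  \<comment> \<open>Index \<open>length V\<close> is the empty target, whose \<open>Reach\<close> is
    empty and cannot have probability 1.\<close>
  have "l \<noteq> length V"
  proof
    assume "l = length V"
    then have "Reach (targets (ov_query d U V) ! l) = {}"
      by (simp add: nth_append Reach_def)
    with win show False
      by simp
  qed
  then have "l < length V"
    using l by simp
  define v where "v = V ! l"
  have v: "v \<in> set V"
    using \<open>l < length V\<close> by (simp add: v_def)
  have win: "measure (play_measure ?P \<sigma> (3 * d)) (Reach (ov_target d v)) = 1"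
    using win \<open>l < length V\<close> by (simp add: v_def nth_append)
  have start: "3 * d \<in> verts ?P"
    by simp
  note absorbing = consistent_play_absorbing[OF is_mdp_ov_mdp \<sigma> start]
  have "path_prefix ?P [3 * d]"
    by (simp add: path_prefix_def)
  then have "\<sigma> [3 * d] \<in> ov_succ d U (3 * d)"
    using \<sigma> by (force simp: strategy_def)
  then have "\<sigma> [3 * d] = 3 * d + 1 \<or> (\<exists>j<length U. \<sigma> [3 * d] = 3 * d + 2 + j)"
    by (simp add: ov_succ_def) presburger
  \<comment> \<open>\<open>3 * d + 1\<close> is absorbing and lies above all targets, so moving
    there loses.\<close>
  moreover have "\<sigma> [3 * d] \<noteq> 3 * d + 1"
  proof
    let ?h = "[3 * d, 3 * d + 1]"
    assume *: "\<sigma> [3 * d] = 3 * d + 1"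
    have "?h ! i \<in> set_pmf (next_vertex ?P \<sigma> (3 * d) (take i ?h))" if "i < length ?h" for i
      using that * by (auto simp: next_vertex_def less_Suc_eq)
    from measure_Reach_eq_1_prefix[OF win this] obtain \<omega> n where
      \<omega>: "map \<omega> [0..<length ?h] = ?h" "\<omega> n \<in> ov_target d v"
        "\<And>n. \<omega> n \<in> set_pmf (next_vertex ?P \<sigma> (3 * d) (map \<omega> [0..<n]))"
      by blast
    have "\<omega> 0 = 3 * d" "\<omega> 1 = 3 * d + 1"
      using \<omega>(1) by simp_all
    moreover have "\<omega> n = 3 * d + 1" if "1 \<le> n" for n
      by (rule absorbing[OF \<omega>(3), where m = 1 and n = n])
         (use \<open>\<omega> 1 = 3 * d + 1\<close> that in \<open>auto simp: ov_succ_def\<close>)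
    moreover have "\<omega> n < 3 * d"
      using ov_target_less[OF v \<omega>(2)] .
    ultimately show False
      by (cases n) auto
  qed
  ultimately obtain j where j: "j < length U" "\<sigma> [3 * d] = 3 * d + 2 + j"
    by blast
  have "U ! j ! i * v ! i = 0" if i: "i < d" for i
  proof (rule ccontr)
    assume "U ! j ! i * v ! i \<noteq> 0"
    then have one: "U ! j ! i = 1" "v ! i = 1"
      using coord_le_1(1)[of "U ! j" i] coord_le_1(2)[OF v i] j(1) i by (auto simp: le_Suc_eq)
    \<comment> \<open>The losing branch: drawing \<open>i\<close> traps the play at
      \<open>3 * i + 1\<close>, whereas the target of \<open>v\<close> contains
      \<open>3 * i + 2\<close> for this coordinate.\<close>
    let ?h = "[3 * d, 3 * d + 2 + j, 3 * i + 1]"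
    have "3 * i + 1 \<in> ov_succ d U (3 * d + 2 + j)"
      unfolding ov_succ_vector using i one(1) by force
    then have "3 * i + 1 \<in> set_pmf (pmf_of_set (ov_succ d U (3 * d + 2 + j)))"
      using ov_succ_nonempty by (simp add: set_pmf_of_set)
    then have "?h ! k \<in> set_pmf (next_vertex ?P \<sigma> (3 * d) (take k ?h))" if "k < length ?h" for k
      using that j(2) by (auto simp: next_vertex_def less_Suc_eq)
    from measure_Reach_eq_1_prefix[OF win this] obtain \<omega> n where
      \<omega>: "map \<omega> [0..<length ?h] = ?h" "\<omega> n \<in> ov_target d v"
        "\<And>n. \<omega> n \<in> set_pmf (next_vertex ?P \<sigma> (3 * d) (map \<omega> [0..<n]))"
      by blast
    have \<omega>_init: "\<omega> 0 = 3 * d" "\<omega> 1 = 3 * d + 2 + j" "\<omega> 2 = 3 * i + 1"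
      using \<omega>(1) by (simp_all add: numeral_2_eq_2)
    have less: "3 * i + 1 < 3 * d"
      using i by simp
    have "(3 * i + 1) mod 3 \<noteq> 0"
      by presburger
    then have "\<omega> n = 3 * i + 1" if "2 \<le> n" for n
      by - (rule absorbing[OF \<omega>(3), where m = 2 and n = n],
        use \<omega>_init(3) that less in \<open>auto simp: ov_succ_def\<close>)
    moreover have "\<omega> n < 3 * d"
      using ov_target_less[OF v \<omega>(2)] .
    then have "2 \<le> n"
      using \<omega>_init by (cases "n = 0"; cases "n = 1") auto
    ultimately have "3 * i + 1 \<in> ov_target d v"
      using \<omega>(2) by simp
    then obtain i' where "i' < d" "3 * i + 1 = 3 * i' + 1 + v ! i'"
      by (auto simp: ov_target_def)
    \<comment> \<open>From \<open>3 * i = 3 * i' + v ! i'\<close> and \<open>v ! i' \<le> 1\<close>,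
      divisibility by 3 leaves only \<open>v ! i' = 0\<close>, contradicting
      \<open>v ! i = 1\<close>.\<close>
    moreover from this have "i' = i"
      using coord_le_1(2)[OF v \<open>i' < d\<close>] by arith
    ultimately show False
      using one(2) by simp
  qed
  with that[of "U ! j" v] j(1) v show ?thesis
    by simp
qed

lemma start_winning_iff:
  "3 * d \<in> winning_set (ov_query d U V) \<longleftrightarrow>
     (\<exists>u\<in>set U. \<exists>v\<in>set V. (\<Sum>i<d. u ! i * v ! i) = 0)"
proof
  assume "3 * d \<in> winning_set (ov_query d U V)"
  then obtain u v where "u \<in> set U" "v \<in> set V" "\<And>i. i < d \<Longrightarrow> u ! i * v ! i = 0"
    by (rule orthogonal_if_start_winning) blast
  moreover from this have "(\<Sum>i<d. u ! i * v ! i) = 0"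
    by (intro sum.neutral) auto
  ultimately show "\<exists>u\<in>set U. \<exists>v\<in>set V. (\<Sum>i<d. u ! i * v ! i) = 0"
    by blast
next
  assume "\<exists>u\<in>set U. \<exists>v\<in>set V. (\<Sum>i<d. u ! i * v ! i) = 0"
  then show "3 * d \<in> winning_set (ov_query d U V)"
    using start_winning_if_orthogonal by auto
qed

section \<open>Number of edges and explicit code of the query\<close>

lemma card_edges_le: "card (edges (ov_mdp d U)) \<le> 8 * d + 4 * d * length U"
proof -
  have 1: "card (ov_succ d U x) \<le> 2" if "x < 3 * d" for x
    using that by (simp add: ov_succ_def card_insert_if)
  have 2: "card (ov_succ d U x) \<le> d" if "3 * d + 2 \<le> x" for x
    using that card_image_le[of "{..<d}"] by (fastforce simp: ov_succ_def)
  let ?n = "3 * d + 2 + length U"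
  have "card (edges (ov_mdp d U)) = (\<Sum>x<?n. card (ov_succ d U x))"
    by simp
  also have "{..<?n} = {..<3 * d} \<union> {3 * d, 3 * d + 1} \<union> {3 * d + 2..<?n}"
    by auto
  also have "(\<Sum>x\<in>\<dots>. card (ov_succ d U x)) = (\<Sum>x<3 * d. card (ov_succ d U x)) +
      (card (ov_succ d U (3 * d)) + card (ov_succ d U (3 * d + 1))) +
      (\<Sum>x\<in>{3 * d + 2..<?n}. card (ov_succ d U x))"
    by (subst sum.union_disjoint; (subst sum.union_disjoint)?) auto
  also have "\<dots> \<le> (\<Sum>x<3 * d. 2) + (length U + 1 + 1) + (\<Sum>x\<in>{3 * d + 2..<?n}. d)"
    by (intro add_mono sum_mono 1 2) (auto simp: ov_succ_def)
  also have "\<dots> = 6 * d + length U + 2 + length U * d"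
    by simp
  also have "\<dots> \<le> 8 * d + 4 * d * length U"
    using d_pos by (cases d) (auto simp: algebra_simps)
  finally show ?thesis .
qed

text \<open>The code in the order in which the loops of the program write it. Each vertex
  contributes its owner bit and degree, then its successors; a triple
  \<open>[3 * i + U ! j ! i, 1, d]\<close> is a successor with probability \<open>1 / d\<close>. The
  final 0 is the cardinality of the empty target.\<close>

definition ov_query_code :: "nat list" where
  "ov_query_code =
     [3 * d + 2 + length U] @
     concat (map (\<lambda>i. [1, 2, 3 * i + 1, 3 * i + 2, 1, 1, 3 * i + 1, 1, 1, 3 * i + 2]) [0..<d]) @
     [1, length U + 1] @ map (\<lambda>j. 3 * d + 1 + j) [0..<length U + 1] @ [1, 1, 3 * d + 1] @
     concat (map (\<lambda>j. [0, d] @ concat (map (\<lambda>i. [3 * i + U ! j ! i, 1, d]) [0..<d])) [0..<length U]) @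
     [length V + 1] @
     concat (map (\<lambda>l. [d] @ map (\<lambda>i. 3 * i + 1 + V ! l ! i) [0..<d]) [0..<length V]) @ [0]"

lemma concat_map_upt_triples:
  "concat (map f [0..<3 * n]) = concat (map (\<lambda>i. f (3 * i) @ f (3 * i + 1) @ f (3 * i + 2)) [0..<n])"
proof (induction n)
  case (Suc n)
  have "[0..<3 * Suc n] = [0..<3 * n] @ [3 * n, 3 * n + 1, 3 * n + 2]"
    using upt_add_eq_append[of 0 "3 * n" 3]
    by (simp add: upt_conv_Cons[of "3 * n"] upt_conv_Cons[of "Suc (3 * n)"]
          upt_conv_Cons[of "Suc (Suc (3 * n))"] add.commute)
  with Suc show ?case
    by simp
qed simp

text \<open>The uniform probabilities are already in lowest terms, which spares the program a gcd
  computation.\<close>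

lemma encode_prob_inverse: "encode_prob (1 / real d) = [1, d]"
proof -
  have "(THE r. of_rat r = 1 / real d) = Fract 1 (int d)"
    by (rule the_equality) (use d_pos in \<open>auto simp: of_rat_rat of_rat_eq_iff[symmetric, where 'a=real]\<close>)
  moreover have "quotient_of (Fract 1 (int d)) = (1, int d)"
    using d_pos by (simp add: quotient_of_Fract Rat.normalize_def)
  ultimately show ?thesis
    by (simp add: encode_prob_def)
qed

lemma encode_vertex_vector:
  assumes "j < length U"
  shows "encode_vertex (ov_mdp d U) (3 * d + 2 + j) =
    [0, d] @ concat (map (\<lambda>i. [3 * i + U ! j ! i, 1, d]) [0..<d])"
proof -
  let ?x = "3 * d + 2 + j"
  have mono: "3 * i + U ! j ! i < 3 * i' + U ! j ! i'" if "i < i'" "i' < d" for i i'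
    using coord_le_1(1)[of "U ! j" i] assms that by simp
  have *: "sorted_list_of_set (ov_succ d U ?x) = map (\<lambda>i. 3 * i + U ! j ! i) [0..<d]"
    "card (ov_succ d U ?x) = d"
    using sorted_list_of_set_image_strict_mono[OF mono] unfolding ov_succ_vector by auto
  have pmf: "pmf (pmf_of_set (ov_succ d U ?x)) w = 1 / real d" if "w \<in> ov_succ d U ?x" for w
    using that ov_succ_nonempty * by (simp add: pmf_of_set)
  have "encode_prob (pmf (pmf_of_set (ov_succ d U ?x)) (3 * i + U ! j ! i)) = [1, d]" if "i < d" for i
  proof -
    have "3 * i + U ! j ! i \<in> ov_succ d U ?x"
      using that unfolding ov_succ_vector by blast
    then show ?thesis
      using encode_prob_inverse by (simp only: pmf)
  qed
  then have "concat (map (\<lambda>i. (3 * i + U ! j ! i) #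
        encode_prob (pmf (pmf_of_set (ov_succ d U ?x)) (3 * i + U ! j ! i))) [0..<d]) =
      concat (map (\<lambda>i. [3 * i + U ! j ! i, 1, d]) [0..<d])"
    by (intro arg_cong[of _ _ concat] map_cong) auto
  then show ?thesis
    using assms by (simp add: encode_vertex_def * o_def del: add_2_eq_Suc' add_2_eq_Suc)
qed

lemma encode_ov_target:
  assumes "v \<in> set V"
  shows "card (ov_target d v) # sorted_list_of_set (ov_target d v) = [d] @ map (\<lambda>i. 3 * i + 1 + v ! i) [0..<d]"
proof -
  have mono: "3 * i + 1 + v ! i < 3 * i' + 1 + v ! i'" if "i < i'" "i' < d" for i i'
    using coord_le_1(2)[OF assms, of i] that by simp
  show ?thesis
    using sorted_list_of_set_image_strict_mono[OF mono] by (simp add: ov_target_def)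
qed

lemma encode_query_ov_query: "encode_query (ov_query d U V) = ov_query_code"
proof -
  let ?f = "encode_vertex (ov_mdp d U)"
  have coord: "?f (3 * i) @ ?f (3 * i + 1) @ ?f (3 * i + 2) =
      [1, 2, 3 * i + 1, 3 * i + 2, 1, 1, 3 * i + 1, 1, 1, 3 * i + 2]" if "i < d" for i
  proof -
    have "Suc (3 * i) mod 3 \<noteq> 0" "Suc (Suc (3 * i)) mod 3 \<noteq> 0" "Suc (3 * i) < 3 * d" "Suc (Suc (3 * i)) < 3 * d"
      using that by presburger+
    then show ?thesis
      using that by (simp add: encode_vertex_def ov_succ_def)
  qed
  have "concat (map ?f [0..<3 * d]) = concat (map (\<lambda>i.
      [1, 2, 3 * i + 1, 3 * i + 2, 1, 1, 3 * i + 1, 1, 1, 3 * i + 2]) [0..<d])"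
    unfolding concat_map_upt_triples
    by (intro arg_cong[of _ _ concat] map_cong refl coord) auto
  moreover have "?f (3 * d) = [1, length U + 1] @ map (\<lambda>j. 3 * d + 1 + j) [0..<length U + 1]"
  proof -
    have "[3 * d + 1..<3 * d + 2 + length U] = map (\<lambda>j. j + (3 * d + 1)) [0..<length U + 1]"
      unfolding map_add_upt by (simp add: ac_simps)
    then have "[3 * d + 1..<3 * d + 2 + length U] = map (\<lambda>j. 3 * d + 1 + j) [0..<length U + 1]"
      by (simp only: add.commute)
    then show ?thesis
      by (simp add: encode_vertex_def ov_succ_def o_def del: upt_Suc)
  qed
  moreover have "?f (3 * d + 1) = [1, 1, 3 * d + 1]"
    by (simp add: encode_vertex_def ov_succ_def)
  moreover have "concat (map ?f [3 * d + 2..<3 * d + 2 + length U]) =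
      concat (map (\<lambda>j. [0, d] @ concat (map (\<lambda>i. [3 * i + U ! j ! i, 1, d]) [0..<d])) [0..<length U])"
  proof -
    have "[3 * d + 2..<3 * d + 2 + length U] = map (\<lambda>j. j + (3 * d + 2)) [0..<length U]"
      unfolding map_add_upt by (simp add: ac_simps)
    then have *: "[3 * d + 2..<3 * d + 2 + length U] = map (\<lambda>j. 3 * d + 2 + j) [0..<length U]"
      by (simp only: add.commute)
    show ?thesis
      unfolding * map_map o_def
      by (intro arg_cong[of _ _ concat] map_cong refl encode_vertex_vector) simp
  qed
  moreover have "[0..<3 * d + 2 + length U] =
      [0..<3 * d] @ [3 * d, 3 * d + 1] @ [3 * d + 2..<3 * d + 2 + length U]"
    using upt_add_eq_append[of 0 "3 * d" "2 + length U"] by (simp add: upt_conv_Cons ac_simps del: upt_Suc)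
  moreover have "concat (map (\<lambda>T. card T # sorted_list_of_set T) (map (ov_target d) V)) =
      concat (map (\<lambda>l. [d] @ map (\<lambda>i. 3 * i + 1 + V ! l ! i) [0..<d]) [0..<length V])"
  proof -
    have "map (\<lambda>T. card T # sorted_list_of_set T) (map (ov_target d) V) =
        map (\<lambda>v. [d] @ map (\<lambda>i. 3 * i + 1 + v ! i) [0..<d]) V"
      using encode_ov_target by simp
    also have "\<dots> = map (\<lambda>v. [d] @ map (\<lambda>i. 3 * i + 1 + v ! i) [0..<d]) (map ((!) V) [0..<length V])"
      by (simp only: map_nth)
    finally show ?thesis
      by (simp add: o_def)
  qed
  ultimately show ?thesis
    by (simp add: encode_query_def ov_query_code_def)
qed

end

section \<open>Executions of word RAM programs\<close>

text \<open>Otherwise register 1 would turn into \<open>Suc 0\<close>, while the other registers remain numerals.\<close>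

declare One_nat_def [simp del]

inductive_cases exec_SkipE: "exec W Skip s t s'"
inductive_cases exec_ConstE: "exec W (Const x n) s t s'"
inductive_cases exec_OpE: "exec W (Op f x y z) s t s'"
inductive_cases exec_LoadE: "exec W (Load x a y) s t s'"
inductive_cases exec_StoreE: "exec W (Store a y x) s t s'"
inductive_cases exec_SeqE: "exec W (Seq p q) s t s'"
inductive_cases exec_IfE: "exec W (If x p q) s t s'"
inductive_cases exec_WhileE: "exec W (While x p) s t s'"

text \<open>\<open>W\<close> occurs only as an upper bound on results. An algorithm can therefore be
  run inside the reduction, or on a longer input, under a larger word bound.\<close>

lemma exec_mono: "exec W p s t s' \<Longrightarrow> W \<le> W' \<Longrightarrow> exec W' p s t s'"
proof (induction rule: exec.induct)
  case (exec_Const n x s)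
  then show ?case by (intro exec.exec_Const) simp
next
  case (exec_Op f s y z x)
  then show ?case by (intro exec.exec_Op) simp
qed (blast intro: exec.intros)+

lemma exec_deterministic:
  "exec W p s t s' \<Longrightarrow> exec W p s u s'' \<Longrightarrow> s'' = s'"
proof (induction arbitrary: u s'' rule: exec.induct)
  case (exec_Seq p s t s' q u s'' v s''')
  then show ?case by (blast elim: exec_SeqE)
next
  case (exec_If_true s x p t s' q)
  from exec_If_true.prems exec_If_true.hyps(1) exec_If_true.IH show ?case
    by (elim exec_IfE) auto
next
  case (exec_If_false s x q t s' p)
  from exec_If_false.prems exec_If_false.hyps(1) exec_If_false.IH show ?case
    by (elim exec_IfE) auto
next
  case (exec_While_true s x p t s' u s'' v r)
  obtain t1 s1 u1 where "exec W p s t1 s1" "exec W (While x p) s1 u1 r"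
    by (rule exec_WhileE[OF exec_While_true.prems]) (use exec_While_true.hyps(1) in auto)
  with exec_While_true.IH show ?case
    by metis
next
  case (exec_While_false s x p)
  show ?case
    by (rule exec_WhileE[OF exec_While_false.prems]) (use exec_While_false.hyps in auto)
qed (blast elim: exec_SkipE exec_ConstE exec_OpE exec_LoadE exec_StoreE)+

section \<open>Renaming registers and arrays\<close>

text \<open>Makes room for the reduction. With \<open>k = 20\<close> and \<open>l = 2\<close>, array
  2, into which the reduction writes the query, becomes the input array of the renamed algorithm,
  and its output appears in array 3.\<close>

fun shift_cmd :: "nat \<Rightarrow> nat \<Rightarrow> cmd \<Rightarrow> cmd" where
  "shift_cmd k l Skip = Skip"
| "shift_cmd k l (Const x n) = Const (x + k) n"
| "shift_cmd k l (Op f x y z) = Op f (x + k) (y + k) (z + k)"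
| "shift_cmd k l (Load x a y) = Load (x + k) (a + l) (y + k)"
| "shift_cmd k l (Store a y x) = Store (a + l) (y + k) (x + k)"
| "shift_cmd k l (Seq p q) = Seq (shift_cmd k l p) (shift_cmd k l q)"
| "shift_cmd k l (If x p q) = If (x + k) (shift_cmd k l p) (shift_cmd k l q)"
| "shift_cmd k l (While x p) = While (x + k) (shift_cmd k l p)"

text \<open>\<open>u\<close> contains the memory of \<open>s\<close> shifted up by \<open>k\<close>
  and \<open>l\<close>; below the shift it agrees with the frame \<open>r\<close>, which the renamed
  program cannot touch.\<close>

definition embeds :: "nat \<Rightarrow> nat \<Rightarrow> state \<Rightarrow> state \<Rightarrow> state \<Rightarrow> bool" where
  "embeds k l r s u \<longleftrightarrow>
     (\<forall>x. reg u (x + k) = reg s x) \<and> (\<forall>x<k. reg u x = reg r x) \<and>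
     (\<forall>a. arr u (a + l) = arr s a) \<and> (\<forall>a<l. arr u a = arr r a)"

lemma embeds_reg:
  "embeds k l r s u \<Longrightarrow>
   embeds k l r (s\<lparr>reg := (reg s)(x := v)\<rparr>) (u\<lparr>reg := (reg u)(x + k := v)\<rparr>)"
  by (simp add: embeds_def)

lemma embeds_arr:
  "embeds k l r s u \<Longrightarrow>
   embeds k l r (s\<lparr>arr := (arr s)(a := v)\<rparr>) (u\<lparr>arr := (arr u)(a + l := v)\<rparr>)"
  by (simp add: embeds_def)

lemma exec_shift_cmd:
  assumes "exec W p s t s'" "embeds k l r s u"
  obtains u' where "exec W (shift_cmd k l p) u t u'" "embeds k l r s' u'"
proof -
  have "\<exists>u'. exec W (shift_cmd k l p) u t u' \<and> embeds k l r s' u'"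
    using assms
  proof (induction arbitrary: u rule: exec.induct)
    case (exec_Skip s)
    then show ?case by (auto intro: exec.exec_Skip)
  next
    case (exec_Const n x s)
    have "exec W (Const (x + k) n) u 1 (u\<lparr>reg := (reg u)(x + k := n)\<rparr>)"
      using exec_Const.hyps by (rule exec.exec_Const)
    with embeds_reg[OF exec_Const.prems] show ?case
      by auto
  next
    case (exec_Op f s y z x)
    from exec_Op.prems have *: "reg u (y + k) = reg s y" "reg u (z + k) = reg s z"
      by (simp_all add: embeds_def)
    have "exec W (Op f (x + k) (y + k) (z + k)) u 1
        (u\<lparr>reg := (reg u)(x + k := eval_binop f (reg s y) (reg s z))\<rparr>)"
      using exec.exec_Op[of f u "y + k" "z + k" W "x + k"] exec_Op.hyps by (simp add: *)
    with embeds_reg[OF exec_Op.prems] show ?case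
      by auto
  next
    case (exec_Load x a y s)
    then have *: "reg u (y + k) = reg s y" "arr u (a + l) = arr s a"
      by (simp_all add: embeds_def)
    have "exec W (Load (x + k) (a + l) (y + k)) u 1
        (u\<lparr>reg := (reg u)(x + k := arr s a (reg s y))\<rparr>)"
      using exec.exec_Load[of W "x + k" "a + l" "y + k" u] by (simp add: *)
    with embeds_reg[OF exec_Load.prems] show ?case
      by auto
  next
    case (exec_Store a y x s)
    then have *: "reg u (y + k) = reg s y" "reg u (x + k) = reg s x" "arr u (a + l) = arr s a"
      by (simp_all add: embeds_def)
    have "exec W (Store (a + l) (y + k) (x + k)) u 1
        (u\<lparr>arr := (arr u)(a + l := (arr s a)(reg s y := reg s x))\<rparr>)"
      using exec.exec_Store[of W "a + l" "y + k" "x + k" u] by (simp add: *)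
    with embeds_arr[OF exec_Store.prems] show ?case
      by auto
  next
    case (exec_Seq p s t s' q v s'')
    then show ?case by (metis exec.exec_Seq shift_cmd.simps(6))
  next
    case (exec_If_true s x p t s' q)
    then have "reg u (x + k) \<noteq> 0" by (simp add: embeds_def)
    with exec_If_true show ?case
      by (metis exec.exec_If_true shift_cmd.simps(7))
  next
    case (exec_If_false s x q t s' p)
    then have "reg u (x + k) = 0" by (simp add: embeds_def)
    with exec_If_false show ?case
      by (metis exec.exec_If_false shift_cmd.simps(7))
  next
    case (exec_While_true s x p t s' v s'')
    then have "reg u (x + k) \<noteq> 0" by (simp add: embeds_def)
    with exec_While_true show ?case
      by (metis exec.exec_While_true shift_cmd.simps(8))
  next
    case (exec_While_false s x p)
    then have "reg u (x + k) = 0" by (simp add: embeds_def)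
    with exec_While_false show ?case
      by (metis exec.exec_While_false shift_cmd.simps(8))
  qed
  with that show ?thesis by blast
qed

section \<open>Unread cells\<close>

definition agree_off :: "nat \<Rightarrow> nat \<Rightarrow> state \<Rightarrow> state \<Rightarrow> bool" where
  "agree_off a i s u \<longleftrightarrow> reg u = reg s \<and> (\<forall>b j. (b, j) \<noteq> (a, i) \<longrightarrow> arr u b j = arr s b j)"

definition reads_within :: "nat \<Rightarrow> nat \<Rightarrow> cmd \<Rightarrow> state \<Rightarrow> nat \<Rightarrow> state \<Rightarrow> nat set \<Rightarrow> bool" where
  "reads_within a W p s t s' R \<longleftrightarrow>
     (\<forall>i u. i \<notin> R \<longrightarrow> agree_off a i s u \<longrightarrow> (\<exists>u'. exec W p u t u' \<and> agree_off a i s' u'))"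

text \<open>\<open>R\<close> collects the indices of all executed loads, from whichever array, and
  each load costs a step. If cell \<open>i\<close> is never loaded, a change there cannot enter a
  register, so control flow and addresses stay the same; the cell either keeps its difference or is
  overwritten identically in both runs.\<close>

lemma exec_reads_within:
  "exec W p s t s' \<Longrightarrow> \<exists>R. finite R \<and> card R \<le> t \<and> reads_within a W p s t s' R"
proof (induction rule: exec.induct)
  case (exec_Skip s)
  have "reads_within a W Skip s 1 s {}"
    unfolding reads_within_def by (blast intro: exec.exec_Skip)
  then show ?case
    by (intro exI[of _ "{}"]) simp
next
  case (exec_Const n x s)
  have "reads_within a W (Const x n) s 1 (s\<lparr>reg := (reg s)(x := n)\<rparr>) {}"
    unfolding reads_within_def
  proof (intro allI impI exI conjI)
    fix i u assume *: "agree_off a i s u"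
    show "exec W (Const x n) u 1 (u\<lparr>reg := (reg u)(x := n)\<rparr>)"
      using exec_Const by (rule exec.exec_Const)
    show "agree_off a i (s\<lparr>reg := (reg s)(x := n)\<rparr>) (u\<lparr>reg := (reg u)(x := n)\<rparr>)"
      using * by (simp add: agree_off_def)
  qed
  then show ?case
    by (intro exI[of _ "{}"]) simp
next
  case (exec_Op f s y z x)
  let ?f = "\<lambda>s. s\<lparr>reg := (reg s)(x := eval_binop f (reg s y) (reg s z))\<rparr>"
  have "reads_within a W (Op f x y z) s 1 (?f s) {}"
    unfolding reads_within_def
  proof (intro allI impI exI conjI)
    fix i u assume *: "agree_off a i s u"
    show "exec W (Op f x y z) u 1 (?f u)"
      using exec_Op * by (intro exec.exec_Op) (simp add: agree_off_def)
    show "agree_off a i (?f s) (?f u)"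
      using * by (simp add: agree_off_def)
  qed
  then show ?case
    by (intro exI[of _ "{}"]) simp
next
  case (exec_Load x b y s)
  let ?f = "\<lambda>s. s\<lparr>reg := (reg s)(x := arr s b (reg s y))\<rparr>"
  have "reads_within a W (Load x b y) s 1 (?f s) {reg s y}"
    unfolding reads_within_def
  proof (intro allI impI exI conjI)
    fix i u assume *: "agree_off a i s u" "i \<notin> {reg s y}"
    show "exec W (Load x b y) u 1 (?f u)"
      by (rule exec.exec_Load)
    show "agree_off a i (?f s) (?f u)"
      using * by (simp add: agree_off_def)
  qed
  then show ?case
    by (intro exI[of _ "{reg s y}"]) simp
next
  case (exec_Store b y x s)
  let ?f = "\<lambda>s. s\<lparr>arr := (arr s)(b := (arr s b)(reg s y := reg s x))\<rparr>"
  have "reads_within a W (Store b y x) s 1 (?f s) {}"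
    unfolding reads_within_def
  proof (intro allI impI exI conjI)
    fix i u assume *: "agree_off a i s u"
    show "exec W (Store b y x) u 1 (?f u)"
      by (rule exec.exec_Store)
    show "agree_off a i (?f s) (?f u)"
      using * by (simp add: agree_off_def)
  qed
  then show ?case
    by (intro exI[of _ "{}"]) simp
next
  case (exec_Seq p s t s' q v s'')
  from exec_Seq.IH obtain R1 R2 where
    R1: "finite R1" "card R1 \<le> t" "reads_within a W p s t s' R1" and
    R2: "finite R2" "card R2 \<le> v" "reads_within a W q s' v s'' R2"
    by blast
  have "reads_within a W (Seq p q) s (t + v) s'' (R1 \<union> R2)"
    using R1(3) R2(3) unfolding reads_within_def by (metis UnI1 UnI2 exec.exec_Seq)
  moreover have "card (R1 \<union> R2) \<le> t + v"
    using card_Un_le[of R1 R2] R1(2) R2(2) by linarith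
  ultimately show ?case
    using R1(1) R2(1) by blast
next
  case (exec_If_true s x p t s' q)
  from exec_If_true.IH obtain R where
    R: "finite R" "card R \<le> t" "reads_within a W p s t s' R"
    by blast
  have "reads_within a W (If x p q) s (Suc t) s' R"
    using R(3) exec_If_true.hyps(1) unfolding reads_within_def
    by (metis exec.exec_If_true agree_off_def)
  with R(1,2) show ?case
    using le_SucI by blast
next
  case (exec_If_false s x q t s' p)
  from exec_If_false.IH obtain R where
    R: "finite R" "card R \<le> t" "reads_within a W q s t s' R"
    by blast
  have "reads_within a W (If x p q) s (Suc t) s' R"
    using R(3) exec_If_false.hyps(1) unfolding reads_within_def
    by (metis exec.exec_If_false agree_off_def)
  with R(1,2) show ?case
    using le_SucI by blast
next
  case (exec_While_true s x p t s' v s'')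
  from exec_While_true.IH obtain R1 R2 where
    R1: "finite R1" "card R1 \<le> t" "reads_within a W p s t s' R1" and
    R2: "finite R2" "card R2 \<le> v" "reads_within a W (While x p) s' v s'' R2"
    by blast
  have "reads_within a W (While x p) s (Suc (t + v)) s'' (R1 \<union> R2)"
    using R1(3) R2(3) exec_While_true.hyps(1) unfolding reads_within_def
    by (metis UnI1 UnI2 exec.exec_While_true agree_off_def)
  moreover have "card (R1 \<union> R2) \<le> Suc (t + v)"
    using card_Un_le[of R1 R2] R1(2) R2(2) by linarith
  ultimately show ?case
    using R1(1) R2(1) by blast
next
  case (exec_While_false s x p)
  then have "reads_within a W (While x p) s 1 s {}"
    unfolding reads_within_def by (metis exec.exec_While_false agree_off_def)
  then show ?case
    by (intro exI[of _ "{}"]) simp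
qed

section \<open>Weakest preconditions\<close>

definition wp :: "nat \<Rightarrow> cmd \<Rightarrow> (nat \<Rightarrow> state \<Rightarrow> bool) \<Rightarrow> state \<Rightarrow> bool" where
  "wp W p Q s \<longleftrightarrow> (\<exists>t s'. exec W p s t s' \<and> Q t s')"

lemma wp_mono: "wp W p Q s \<Longrightarrow> (\<And>t s'. Q t s' \<Longrightarrow> Q' t s') \<Longrightarrow> wp W p Q' s"
  by (auto simp: wp_def)

lemma wp_Skip: "wp W Skip Q s \<longleftrightarrow> Q 1 s"
  unfolding wp_def by (blast elim: exec_SkipE intro: exec_Skip)

lemma wp_Const: "wp W (Const x n) Q s \<longleftrightarrow> n < W \<and> Q 1 (s\<lparr>reg := (reg s)(x := n)\<rparr>)"
  unfolding wp_def by (blast elim: exec_ConstE intro: exec_Const)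

lemma wp_Op: "wp W (Op f x y z) Q s \<longleftrightarrow> eval_binop f (reg s y) (reg s z) < W \<and>
    Q 1 (s\<lparr>reg := (reg s)(x := eval_binop f (reg s y) (reg s z))\<rparr>)"
  unfolding wp_def by (blast elim: exec_OpE intro: exec_Op)

lemma wp_Load: "wp W (Load x a y) Q s \<longleftrightarrow> Q 1 (s\<lparr>reg := (reg s)(x := arr s a (reg s y))\<rparr>)"
  unfolding wp_def by (blast elim: exec_LoadE intro: exec_Load)

lemma wp_Store: "wp W (Store a y x) Q s \<longleftrightarrow>
    Q 1 (s\<lparr>arr := (arr s)(a := (arr s a)(reg s y := reg s x))\<rparr>)"
  unfolding wp_def by (blast elim: exec_StoreE intro: exec_Store)

lemma wp_Seq: "wp W (Seq p q) Q s \<longleftrightarrow> wp W p (\<lambda>t s'. wp W q (\<lambda>u. Q (t + u)) s') s"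
  unfolding wp_def by (blast elim: exec_SeqE intro: exec_Seq)

lemma wp_While_false: "reg s x = 0 \<Longrightarrow> Q 1 s \<Longrightarrow> wp W (While x p) Q s"
  unfolding wp_def by (blast intro: exec_While_false)

lemma wp_While_true:
  "reg s x \<noteq> 0 \<Longrightarrow> wp W p (\<lambda>t s'. wp W (While x p) (\<lambda>u. Q (Suc (t + u))) s') s \<Longrightarrow> wp W (While x p) Q s"
  unfolding wp_def by (blast intro: exec_While_true)

section \<open>Programs writing a list\<close>

text \<open>
  Array 0 holds the input \<open>X\<close>, array 2 the list \<open>out\<close> written so far, and register 0 its length.
\<close>

definition array_of :: "nat list \<Rightarrow> nat \<Rightarrow> nat" where
  "array_of xs i = (if i < length xs then xs ! i else 0)"

definition writing :: "nat list \<Rightarrow> nat list \<Rightarrow> (nat \<Rightarrow> nat) \<Rightarrow> state" where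
  "writing X out R =
     \<lparr>reg = R(0 := length out),
      arr = (\<lambda>a. if a = 0 then array_of X else if a = 2 then array_of out else (\<lambda>_. 0))\<rparr>"

text \<open>Register 1 permanently holds 1 and serves as the increment.\<close>

definition emit :: "nat \<Rightarrow> cmd" where
  "emit x = Seq (Store 2 0 x) (Op Add 0 0 1)"

lemma array_of_snoc: "(array_of out)(length out := v) = array_of (out @ [v])"
  by (auto simp: array_of_def nth_append fun_eq_iff)

lemma init_state_eq_writing: "init_state xs = writing xs [] (\<lambda>_. 0)"
  by (auto simp: init_state_def writing_def array_of_def fun_eq_iff)

lemma wp_writing_Const:
  "x \<noteq> 0 \<Longrightarrow> wp W (Const x n) Q (writing X out R) \<longleftrightarrow> n < W \<and> Q 1 (writing X out (R(x := n)))"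
  by (auto simp: wp_Const writing_def fun_upd_twist)

lemma wp_writing_Op:
  "x \<noteq> 0 \<Longrightarrow> y \<noteq> 0 \<Longrightarrow> z \<noteq> 0 \<Longrightarrow>
   wp W (Op f x y z) Q (writing X out R) \<longleftrightarrow>
     eval_binop f (R y) (R z) < W \<and> Q 1 (writing X out (R(x := eval_binop f (R y) (R z))))"
  by (auto simp: wp_Op writing_def fun_upd_twist)

lemma wp_writing_Load:
  "x \<noteq> 0 \<Longrightarrow> y \<noteq> 0 \<Longrightarrow>
   wp W (Load x 0 y) Q (writing X out R) \<longleftrightarrow> Q 1 (writing X out (R(x := array_of X (R y))))"
  by (auto simp: wp_Load writing_def fun_upd_twist)

lemma wp_writing_emit:
  "x \<noteq> 0 \<Longrightarrow> R 1 = 1 \<Longrightarrow>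
   wp W (emit x) Q (writing X out R) \<longleftrightarrow>
     Suc (length out) < W \<and> Q 2 (writing X (out @ [R x]) R)"
proof -
  assume *: "x \<noteq> 0" "R 1 = 1"
  have "(\<lambda>a::nat. if a = 0 then array_of X else if a = 2 then array_of out else (\<lambda>_. 0))
      (2 := (array_of out)(length out := R x)) =
    (\<lambda>a. if a = 0 then array_of X else if a = 2 then array_of (out @ [R x]) else (\<lambda>_. 0))"
    unfolding array_of_snoc by (auto simp: fun_eq_iff)
  with * show ?thesis
    by (simp add: emit_def wp_Seq wp_Store wp_Op writing_def Suc_eq_plus1)
qed

definition for_loop :: "nat \<Rightarrow> nat \<Rightarrow> nat \<Rightarrow> cmd \<Rightarrow> cmd" where
  "for_loop i b n p =
     Seq (Const i 0) (Seq (Op Less b i n) (While b (Seq p (Seq (Op Add i i 1) (Op Less b i n)))))"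

text \<open>The output after \<open>k\<close> rounds is given as a function \<open>out k\<close>, so
  the invariant \<open>J\<close> speaks of registers only; it must be insensitive to the counter and
  the loop flag. A round costs the body plus 3 steps (loop test, increment, comparison), and the
  frame costs 3 more (initial constant, first comparison, failing test).\<close>

lemma wp_for_loop:
  assumes body: "\<And>k R. k < m \<Longrightarrow> J k R \<Longrightarrow> R i = k \<Longrightarrow>
      wp W p (\<lambda>t s. t \<le> T \<and> (\<exists>R'. s = writing X (out (Suc k)) R' \<and> J (Suc k) R' \<and> R' i = k))
        (writing X (out k) R)"
    and J: "\<And>k R. J k R \<Longrightarrow> R n = m \<and> R 1 = 1"
    and J_upd: "\<And>k R x. J k R \<Longrightarrow> J k (R(i := x)) \<and> J k (R(b := x))"
    and regs: "i \<noteq> 0" "b \<noteq> 0" "n \<noteq> 0" "i \<noteq> 1" "i \<noteq> n" "b \<noteq> i" "b \<noteq> 1" "b \<noteq> n"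
    and "m < W" "1 < W" and "J 0 R"
    and Q: "\<And>t R'. t \<le> 3 + m * (T + 3) \<Longrightarrow> J m R' \<Longrightarrow> Q t (writing X (out m) R')"
  shows "wp W (for_loop i b n p) Q (writing X (out 0) R)"
proof -
  let ?loop = "While b (Seq p (Seq (Op Add i i 1) (Op Less b i n)))"
  have loop: "wp W ?loop (\<lambda>t s. t \<le> 1 + (m - k) * (T + 3) \<and> (\<exists>R'. s = writing X (out m) R' \<and> J m R'))
      (writing X (out k) R)"
    if "k \<le> m" "J k R" "R i = k" "R b = of_bool (k < m)" for k R
    using that
  proof (induction "m - k" arbitrary: k R)
    case 0
    then show ?case
      using regs by (intro wp_While_false) (auto simp: writing_def)
  next
    case (Suc d)
    then have "k < m" by simp
    have [simp]: "m - k = Suc d" "m - Suc k = d"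
      using Suc.hyps(2) by simp_all
    show ?case
    proof (rule wp_While_true)
      show "reg (writing X (out k) R) b \<noteq> 0"
        using Suc.prems \<open>k < m\<close> regs by (simp add: writing_def)
      show "wp W (Seq p (Seq (Op Add i i 1) (Op Less b i n)))
        (\<lambda>t. wp W ?loop (\<lambda>u s. Suc (t + u) \<le> 1 + (m - k) * (T + 3) \<and>
           (\<exists>R'. s = writing X (out m) R' \<and> J m R'))) (writing X (out k) R)"
      proof (subst wp_Seq, rule wp_mono[OF body[OF \<open>k < m\<close> Suc.prems(2,3)]])
        fix t s assume "t \<le> T \<and> (\<exists>R'. s = writing X (out (Suc k)) R' \<and> J (Suc k) R' \<and> R' i = k)"
        then obtain R' where R': "t \<le> T" "J (Suc k) R'" "R' i = k"
            and s: "s = writing X (out (Suc k)) R'"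
          by blast
        let ?R = "R'(i := Suc k, b := of_bool (Suc k < m))"
        have IH: "wp W ?loop (\<lambda>t s. t \<le> 1 + (m - Suc k) * (T + 3) \<and>
            (\<exists>R'. s = writing X (out m) R' \<and> J m R')) (writing X (out (Suc k)) ?R)"
          using \<open>k < m\<close> R' J_upd regs by (intro Suc.hyps(1)) auto
        then have "wp W ?loop (\<lambda>u s. Suc (t + 2 + u) \<le> 1 + (m - k) * (T + 3) \<and>
            (\<exists>R'. s = writing X (out m) R' \<and> J m R')) (writing X (out (Suc k)) ?R)"
          using R'(1) by (elim wp_mono) auto
        then show "wp W (Seq (Op Add i i 1) (Op Less b i n))
            (\<lambda>u. wp W ?loop (\<lambda>u' s. Suc (t + u + u') \<le> 1 + (m - k) * (T + 3) \<and>
               (\<exists>R'. s = writing X (out m) R' \<and> J m R'))) s"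
          using R' J[OF R'(2)] \<open>k < m\<close> \<open>m < W\<close> \<open>1 < W\<close>
          by (cases "Suc k < m")
             (simp_all add: s wp_Seq wp_writing_Op regs regs[symmetric] flip: Suc_eq_plus1)
      qed
    qed
  qed
  have "J 0 (R(i := 0, b := of_bool (0 < m)))"
    using \<open>J 0 R\<close> J_upd by blast
  from loop[OF _ this]
  have "wp W ?loop (\<lambda>t. Q (1 + (1 + t))) (writing X (out 0) (R(i := 0, b := of_bool (0 < m))))"
    using regs Q by (auto elim!: wp_mono)
  then show ?thesis
    using regs J[OF \<open>J 0 R\<close>] \<open>1 < W\<close>
    by (cases "0 < m") (simp_all add: for_loop_def wp_Seq wp_writing_Op wp_writing_Const)
qed

section \<open>The reduction as a program\<close>

fun seqs :: "cmd list \<Rightarrow> cmd" where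
  "seqs [] = Skip"
| "seqs (p # ps) = Seq p (seqs ps)"

lemmas wp_writing =
  wp_Seq wp_Skip wp_writing_Const wp_writing_Op wp_writing_Load wp_writing_emit

definition coordinate_body :: cmd where
  "coordinate_body = seqs [Op Mul 10 14 7, Op Add 10 10 1, Op Add 11 10 1,
     emit 1, emit 15, emit 10, emit 11, emit 1, emit 1, emit 10, emit 1, emit 1, emit 11]"

definition start_body :: cmd where
  "start_body = seqs [Op Add 10 17 7, emit 10]"

definition vector_body :: cmd where
  "vector_body = seqs [Op Mul 10 14 7, Load 11 0 5, Op Add 10 10 11,
     emit 10, emit 1, emit 2, Op Add 5 5 1]"

definition target_body :: cmd where
  "target_body = seqs [Op Mul 10 14 7, Op Add 10 10 1, Load 11 0 5, Op Add 10 10 11,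
     emit 10, Op Add 5 5 1]"

text \<open>
  Registers: 2, 3, 4 hold \<open>d\<close>, \<open>|U|\<close>, \<open>|V|\<close>; 5 the input position; 6 and 7 the loop counters, with
  loop conditions in 8 and 9; 10 and 11 intermediate values; 12 to 17 constants; 20 and above are
  reserved for the query algorithm.
\<close>

definition constants :: "nat \<Rightarrow> nat \<Rightarrow> nat \<Rightarrow> (nat \<Rightarrow> nat) \<Rightarrow> bool" where
  "constants d m n R \<longleftrightarrow> R 1 = 1 \<and> R 2 = d \<and> R 3 = m \<and> R 4 = n \<and> R 12 = 0 \<and> R 13 = 3 * d \<and>
     R 14 = 3 \<and> R 15 = 2 \<and> R 16 = m + 1 \<and> R 17 = 3 * d + 1 \<and> (\<forall>x\<ge>20. R x = 0)"

lemma constantsD: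
  assumes "constants d m n R"
  shows "R 1 = 1" "R 2 = d" "R 3 = m" "R 4 = n" "R 12 = 0" "R 13 = 3 * d" "R 14 = 3" "R 15 = 2"
    "R 16 = m + 1" "R 17 = 3 * d + 1" "\<And>x. x \<ge> 20 \<Longrightarrow> R x = 0"
  using assms by (auto simp: constants_def)

lemma constants_upd: "x \<in> {5..11} \<Longrightarrow> constants d m n R \<Longrightarrow> constants d m n (R(x := y))"
  by (auto simp: constants_def)

text \<open>Ends a symbolic execution: what remains is an equation between output lists and a
  condition on the registers.\<close>

lemma writing_exI: "out' = out \<Longrightarrow> K R \<Longrightarrow> \<exists>R'. writing X out' R = writing X out R' \<and> K R'"
  by blast

text \<open>As in the loops below, the bound on \<open>W\<close> leaves room for the final output
  length, which sits in register 0, and for the largest vertex number; the loops that read input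
  also account for the input position.\<close>

lemma wp_coordinate_loop:
  fixes out :: "nat list"
  defines "code \<equiv> \<lambda>i::nat. [1, 2, 3 * i + 1, 3 * i + 2, 1, 1, 3 * i + 1, 1, 1, 3 * i + 2]"
  assumes R: "constants d m n R"
    and W: "length out + 10 * d + 3 * d + 10 < W"
    and Q: "\<And>t R'. t \<le> 3 + d * 33 \<Longrightarrow> constants d m n R' \<Longrightarrow> R' 5 = R 5 \<Longrightarrow>
      Q t (writing X (out @ concat (map code [0..<d])) R')"
  shows "wp W (for_loop 7 9 2 coordinate_body) Q (writing X out R)"
proof -
  let ?out = "\<lambda>k. out @ concat (map code [0..<k])"
  have len: "length (concat (map code [0..<k])) = 10 * k" for k
    by (induction k) (simp_all add: code_def)
  have "wp W (for_loop 7 9 2 coordinate_body) Q (writing X (?out 0) R)"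
  \<comment> \<open>30 is a generous bound common to all four loop bodies; with the 3 steps of loop
    overhead it gives the factor 33.\<close>
  proof (rule wp_for_loop[where m = d and T = 30 and out = ?out and
        J = "\<lambda>_ R'. constants d m n R' \<and> R' 5 = R 5"])
    fix k R' assume k: "k < d" and R': "constants d m n R' \<and> R' 5 = R 5" and i: "R' 7 = k"
    note [simp] = constantsD[OF conjunct1[OF R']] i
    have "10 * k + 10 \<le> 10 * d"
      using k by simp
    then show "wp W coordinate_body
        (\<lambda>t s. t \<le> 30 \<and> (\<exists>R''. s = writing X (?out (Suc k)) R'' \<and>
          (constants d m n R'' \<and> R'' 5 = R 5) \<and> R'' 7 = k)) (writing X (?out k) R')"
      using W R' k
      by (simp add: coordinate_body_def wp_writing len)
         (intro writing_exI, simp_all add: code_def constants_upd)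
  qed (use R W Q in \<open>auto simp: constantsD intro: constants_upd\<close>)
  then show ?thesis
    by simp
qed

lemma wp_start_loop:
  assumes R: "constants d m n R"
    and W: "length out + m + 3 * d + 10 < W"
    and Q: "\<And>t R'. t \<le> 3 + (m + 1) * 33 \<Longrightarrow> constants d m n R' \<Longrightarrow> R' 5 = R 5 \<Longrightarrow>
      Q t (writing X (out @ map (\<lambda>j. 3 * d + 1 + j) [0..<m + 1]) R')"
  shows "wp W (for_loop 7 9 16 start_body) Q (writing X out R)"
proof -
  let ?out = "\<lambda>k. out @ map (\<lambda>j. 3 * d + 1 + j) [0..<k]"
  have "wp W (for_loop 7 9 16 start_body) Q (writing X (?out 0) R)"
  proof (rule wp_for_loop[where m = "m + 1" and T = 30 and out = ?out and
        J = "\<lambda>_ R'. constants d m n R' \<and> R' 5 = R 5"])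
    fix k R' assume k: "k < m + 1" and R': "constants d m n R' \<and> R' 5 = R 5" and i: "R' 7 = k"
    note [simp] = constantsD[OF conjunct1[OF R']] i
    show "wp W start_body
        (\<lambda>t s. t \<le> 30 \<and> (\<exists>R''. s = writing X (?out (Suc k)) R'' \<and>
          (constants d m n R'' \<and> R'' 5 = R 5) \<and> R'' 7 = k)) (writing X (?out k) R')"
      using W R' k
      by (simp add: start_body_def wp_writing)
         (intro writing_exI, simp_all add: constants_upd)
  qed (use R W Q in \<open>auto simp: constantsD intro: constants_upd\<close>)
  then show ?thesis
    by simp
qed

lemma wp_vector_loop:
  fixes out :: "nat list"
  assumes R: "constants d m n R" "R 5 = p"
    and u: "\<And>i. i < d \<Longrightarrow> array_of X (p + i) = u i \<and> u i \<le> 1"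
    and W: "length out + 3 * d + 3 * d + p + d + 10 < W"
    and Q: "\<And>t R'. t \<le> 3 + d * 33 \<Longrightarrow> constants d m n R' \<Longrightarrow> R' 5 = p + d \<Longrightarrow> R' 6 = R 6 \<Longrightarrow>
      Q t (writing X (out @ concat (map (\<lambda>i. [3 * i + u i, 1, d]) [0..<d])) R')"
  shows "wp W (for_loop 7 9 2 vector_body) Q (writing X out R)"
proof -
  let ?out = "\<lambda>k. out @ concat (map (\<lambda>i. [3 * i + u i, 1, d]) [0..<k])"
  have len: "length (concat (map (\<lambda>i. [3 * i + u i, 1, d]) [0..<k])) = 3 * k" for k
    by (induction k) simp_all
  have "wp W (for_loop 7 9 2 vector_body) Q (writing X (?out 0) R)"
  proof (rule wp_for_loop[where m = d and T = 30 and out = ?out and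
        J = "\<lambda>k R'. constants d m n R' \<and> R' 5 = p + k \<and> R' 6 = R 6"])
    fix k R' assume k: "k < d" and R': "constants d m n R' \<and> R' 5 = p + k \<and> R' 6 = R 6" and i: "R' 7 = k"
    note [simp] = constantsD[OF conjunct1[OF R']] i
    have "3 * k + 3 \<le> 3 * d"
      using k by simp
    then show "wp W vector_body
        (\<lambda>t s. t \<le> 30 \<and> (\<exists>R''. s = writing X (?out (Suc k)) R'' \<and>
          (constants d m n R'' \<and> R'' 5 = p + Suc k \<and> R'' 6 = R 6) \<and> R'' 7 = k)) (writing X (?out k) R')"
      using W R' k u[OF k]
      by (simp add: vector_body_def wp_writing len)
         (intro writing_exI, simp_all add: constants_upd)
  qed (use R W Q in \<open>auto simp: constantsD intro: constants_upd\<close>)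
  then show ?thesis
    by simp
qed

lemma wp_target_loop:
  fixes out :: "nat list"
  assumes R: "constants d m n R" "R 5 = p"
    and u: "\<And>i. i < d \<Longrightarrow> array_of X (p + i) = u i \<and> u i \<le> 1"
    and W: "length out + d + 3 * d + p + d + 10 < W"
    and Q: "\<And>t R'. t \<le> 3 + d * 33 \<Longrightarrow> constants d m n R' \<Longrightarrow> R' 5 = p + d \<Longrightarrow> R' 6 = R 6 \<Longrightarrow>
      Q t (writing X (out @ map (\<lambda>i. 3 * i + 1 + u i) [0..<d]) R')"
  shows "wp W (for_loop 7 9 2 target_body) Q (writing X out R)"
proof -
  let ?out = "\<lambda>k. out @ map (\<lambda>i. 3 * i + 1 + u i) [0..<k]"
  have "wp W (for_loop 7 9 2 target_body) Q (writing X (?out 0) R)"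
  proof (rule wp_for_loop[where m = d and T = 30 and out = ?out and
        J = "\<lambda>k R'. constants d m n R' \<and> R' 5 = p + k \<and> R' 6 = R 6"])
    fix k R' assume k: "k < d" and R': "constants d m n R' \<and> R' 5 = p + k \<and> R' 6 = R 6" and i: "R' 7 = k"
    note [simp] = constantsD[OF conjunct1[OF R']] i
    show "wp W target_body
        (\<lambda>t s. t \<le> 30 \<and> (\<exists>R''. s = writing X (?out (Suc k)) R'' \<and>
          (constants d m n R'' \<and> R'' 5 = p + Suc k \<and> R'' 6 = R 6) \<and> R'' 7 = k)) (writing X (?out k) R')"
      using W R' k u[OF k]
      by (simp add: target_body_def wp_writing)
         (intro writing_exI, simp_all add: constants_upd)
  qed (use R W Q in \<open>auto simp: constantsD intro: constants_upd\<close>)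
  then show ?thesis
    by simp
qed

text \<open>The inner loop advances the input position by \<open>d\<close>, so before round
  \<open>k\<close> register 5 points at the \<open>k\<close>-th vector. The inner loop must also
  preserve register 6, the outer counter, hence the clause \<open>R' 6 = R 6\<close> in
  \<open>wp_vector_loop\<close>.\<close>

lemma wp_vectors_loop:
  fixes out :: "nat list" and d :: nat
  defines "code \<equiv> \<lambda>U j. [0, d] @ concat (map (\<lambda>i. [3 * i + U j i, 1, d]) [0..<d])"
  assumes R: "constants d m n R" "R 5 = p"
    and U: "\<And>j i. j < m \<Longrightarrow> i < d \<Longrightarrow> array_of X (p + j * d + i) = U j i \<and> U j i \<le> 1"
    and W: "length out + m * (2 + 3 * d) + 3 * d + p + m * d + d + 10 < W"
    and Q: "\<And>t R'. t \<le> 3 + m * (13 + d * 33) \<Longrightarrow> constants d m n R' \<Longrightarrow> R' 5 = p + m * d \<Longrightarrow>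
      Q t (writing X (out @ concat (map (code U) [0..<m])) R')"
  shows "wp W (for_loop 6 8 3 (seqs [emit 12, emit 2, for_loop 7 9 2 vector_body])) Q (writing X out R)"
proof -
  let ?out = "\<lambda>k. out @ concat (map (code U) [0..<k])"
  have len': "length (concat (map (\<lambda>i. [3 * i + U j i, 1, d]) [0..<k])) = 3 * k" for j k
    by (induction k) simp_all
  have len: "length (concat (map (code U) [0..<k])) = k * (2 + 3 * d)" for k
    by (induction k) (simp_all add: code_def len')
  have "wp W (for_loop 6 8 3 (seqs [emit 12, emit 2, for_loop 7 9 2 vector_body])) Q (writing X (?out 0) R)"
  proof (rule wp_for_loop[where m = m and T = "10 + d * 33" and out = ?out and
        J = "\<lambda>k R'. constants d m n R' \<and> R' 5 = p + k * d"])
    fix k R' assume k: "k < m" and R': "constants d m n R' \<and> R' 5 = p + k * d" and i: "R' 6 = k"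
    note [simp] = constantsD[OF conjunct1[OF R']] i
    have k1: "k * (2 + 3 * d) + (2 + 3 * d) \<le> m * (2 + 3 * d)"
      using mult_le_mono1[of "Suc k" m "2 + 3 * d"] k by simp
    have k2: "k * d + d \<le> m * d"
      using mult_le_mono1[of "Suc k" m d] k by simp
    have W': "length (?out k @ [0, d]) + 3 * d + 3 * d + (p + k * d) + d + 10 < W"
      using k1 k2 W by (simp add: len algebra_simps)
    have "wp W (for_loop 7 9 2 vector_body)
       (\<lambda>t s. t + 5 \<le> 10 + d * 33 \<and> (\<exists>R''. s = writing X (?out (Suc k)) R'' \<and>
          (constants d m n R'' \<and> R'' 5 = p + Suc k * d) \<and> R'' 6 = k)) (writing X (?out k @ [0, d]) R')"
      by (rule wp_vector_loop[where p = "p + k * d" and u = "U k" and m = m and n = n, OF _ _ _ W'])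
         (use R' U[OF k] in \<open>auto simp: code_def intro!: exI\<close>)
    moreover have "length (?out k @ [0, d]) < W"
      using W' by linarith
    ultimately show "wp W (seqs [emit 12, emit 2, for_loop 7 9 2 vector_body])
        (\<lambda>t s. t \<le> 10 + d * 33 \<and> (\<exists>R''. s = writing X (?out (Suc k)) R'' \<and>
          (constants d m n R'' \<and> R'' 5 = p + Suc k * d) \<and> R'' 6 = k)) (writing X (?out k) R')"
      by (simp add: wp_writing len)
  qed (use R W Q in \<open>auto simp: constantsD intro: constants_upd\<close>)
  then show ?thesis
    by simp
qed

lemma wp_targets_loop:
  fixes out :: "nat list" and d :: nat
  defines "code \<equiv> \<lambda>V j. [d] @ map (\<lambda>i. 3 * i + 1 + V j i) [0..<d]"
  assumes R: "constants d m n R" "R 5 = p"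
    and V: "\<And>j i. j < n \<Longrightarrow> i < d \<Longrightarrow> array_of X (p + j * d + i) = V j i \<and> V j i \<le> 1"
    and W: "length out + n * (1 + d) + 3 * d + p + n * d + d + 10 < W"
    and Q: "\<And>t R'. t \<le> 3 + n * (13 + d * 33) \<Longrightarrow> constants d m n R' \<Longrightarrow>
      Q t (writing X (out @ concat (map (code V) [0..<n])) R')"
  shows "wp W (for_loop 6 8 4 (seqs [emit 2, for_loop 7 9 2 target_body])) Q (writing X out R)"
proof -
  let ?out = "\<lambda>k. out @ concat (map (code V) [0..<k])"
  have len: "length (concat (map (code V) [0..<k])) = k * (1 + d)" for k
    by (induction k) (simp_all add: code_def)
  have "n < W"
    using W by (simp add: algebra_simps)
  have "wp W (for_loop 6 8 4 (seqs [emit 2, for_loop 7 9 2 target_body])) Q (writing X (?out 0) R)"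
  proof (rule wp_for_loop[where m = n and T = "10 + d * 33" and out = ?out and
        J = "\<lambda>k R'. constants d m n R' \<and> R' 5 = p + k * d"])
    fix k R' assume k: "k < n" and R': "constants d m n R' \<and> R' 5 = p + k * d" and i: "R' 6 = k"
    note [simp] = constantsD[OF conjunct1[OF R']] i
    have k1: "k * (1 + d) + (1 + d) \<le> n * (1 + d)"
      using mult_le_mono1[of "Suc k" n "1 + d"] k by simp
    have k2: "k * d + d \<le> n * d"
      using mult_le_mono1[of "Suc k" n d] k by simp
    have W': "length (?out k @ [d]) + d + 3 * d + (p + k * d) + d + 10 < W"
      using k1 k2 W by (simp add: len)
    have "wp W (for_loop 7 9 2 target_body)
       (\<lambda>t s. t + 3 \<le> 10 + d * 33 \<and> (\<exists>R''. s = writing X (?out (Suc k)) R'' \<and>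
          (constants d m n R'' \<and> R'' 5 = p + Suc k * d) \<and> R'' 6 = k)) (writing X (?out k @ [d]) R')"
      by (rule wp_target_loop[where p = "p + k * d" and u = "V k" and m = m and n = n, OF _ _ _ W'])
         (use R' V[OF k] in \<open>auto simp: code_def intro!: exI\<close>)
    then show "wp W (seqs [emit 2, for_loop 7 9 2 target_body])
        (\<lambda>t s. t \<le> 10 + d * 33 \<and> (\<exists>R''. s = writing X (?out (Suc k)) R'' \<and>
          (constants d m n R'' \<and> R'' 5 = p + Suc k * d) \<and> R'' 6 = k)) (writing X (?out k) R')"
      using W' by (simp add: wp_writing len)
  qed (use R W Q \<open>n < W\<close> in \<open>auto simp: constantsD intro: constants_upd\<close>)
  then show ?thesis
    by simp
qed

lemma wp_Seq_bounded:
  assumes "wp W p (\<lambda>t s'. t \<le> T \<and> A s') s"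
    and "\<And>s'. A s' \<Longrightarrow> wp W q (\<lambda>t s''. t \<le> T' \<and> B s'') s'"
  shows "wp W (Seq p q) (\<lambda>t s'. t \<le> T + T' \<and> B s') s"
  unfolding wp_Seq
  by (rule wp_mono[OF assms(1)]) (auto elim!: wp_mono dest!: assms(2))

text \<open>The constants 1, 2, 3 in registers 1, 15, 14 double as the input indices of
  \<open>d\<close>, \<open>length U\<close> and \<open>length V\<close>; the vectors begin at index
  4. Register 10 receives \<open>(3 * d + 1) + (length U + 1)\<close>, the number of
  vertices.\<close>

definition query_writer_init :: "bool \<Rightarrow> cmd" where
  "query_writer_init b = seqs [Const 1 1, Const 14 3, Const 15 2, Load 2 0 1, Load 3 0 15, Load 4 0 14,
     Op Mul 13 14 2, Op Add 16 3 1, Const 5 4, Op Add 17 13 1,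
     if b then emit 13 else Skip, Op Add 10 17 16, emit 10]"

text \<open>The flag \<open>b\<close> selects the membership problem, whose input begins with the vertex in question.\<close>

definition query_writer :: "bool \<Rightarrow> cmd" where
  "query_writer b =
     Seq (query_writer_init b)
    (Seq (for_loop 7 9 2 coordinate_body)
    (Seq (seqs [emit 1, emit 16, for_loop 7 9 16 start_body])
    (Seq (seqs [emit 1, emit 1, emit 17,
            for_loop 6 8 3 (seqs [emit 12, emit 2, for_loop 7 9 2 vector_body])])
         (seqs [Op Add 10 4 1, emit 10,
            for_loop 6 8 4 (seqs [emit 2, for_loop 7 9 2 target_body]), emit 12]))))"

lemma concat_nth_uniform:
  assumes "\<And>u. u \<in> set L \<Longrightarrow> length u = d"
  shows "length (concat L) = length L * d"
    and "j < length L \<Longrightarrow> i < d \<Longrightarrow> concat L ! (j * d + i) = L ! j ! i"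
proof -
  show "length (concat L) = length L * d"
    using assms by (induction L) simp_all
  show "j < length L \<Longrightarrow> i < d \<Longrightarrow> concat L ! (j * d + i) = L ! j ! i"
    using assms
  proof (induction L arbitrary: j)
    case (Cons u L)
    then show ?case
      by (cases j) (simp_all add: nth_append add.assoc)
  qed simp
qed

text \<open>The common yardstick for code lengths and running times. The summand \<open>d\<close>
  keeps it positive when both lists of vectors are empty, so that additive constants can be
  absorbed.\<close>

definition ov_size :: "nat \<Rightarrow> nat list list \<Rightarrow> nat list list \<Rightarrow> nat" where
  "ov_size d U V = d + d * length U + d * length V"

context ov_reduction
begin

definition ov_code :: "nat \<Rightarrow> nat list" where
  "ov_code N = [N, d, length U, length V] @ concat U @ concat V"

lemma array_of_ov_code:
  "j < length U \<Longrightarrow> i < d \<Longrightarrow> array_of (ov_code N) (4 + j * d + i) = U ! j ! i"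
  "j < length V \<Longrightarrow> i < d \<Longrightarrow> array_of (ov_code N) (4 + length U * d + j * d + i) = V ! j ! i"
proof -
  let ?L = "U @ V"
  have L: "\<And>u. u \<in> set ?L \<Longrightarrow> length u = d"
    using vectors by auto
  have *: "array_of (ov_code N) (4 + j * d + i) = ?L ! j ! i" if "j < length ?L" "i < d" for j i
  proof -
    have "j * d + i < length ?L * d"
      using mult_le_mono1[of "Suc j" "length ?L" d] that by simp
    then have "array_of (ov_code N) (4 + j * d + i) = concat ?L ! (j * d + i)"
      using concat_nth_uniform(1)[where L = ?L, OF L]
      by (simp add: array_of_def ov_code_def nth_append flip: concat_append)
    then show ?thesis
      using concat_nth_uniform(2)[OF L that] by simp
  qed
  show "j < length U \<Longrightarrow> i < d \<Longrightarrow> array_of (ov_code N) (4 + j * d + i) = U ! j ! i"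
    using *[of j i] by (simp add: nth_append)
  show "j < length V \<Longrightarrow> i < d \<Longrightarrow> array_of (ov_code N) (4 + length U * d + j * d + i) = V ! j ! i"
    using *[of "length U + j" i] by (simp add: nth_append algebra_simps)
qed

lemma length_code_parts:
  "length (concat (map (\<lambda>i. [1, 2, 3 * i + 1, 3 * i + 2, 1, 1, 3 * i + 1, 1, 1, 3 * i + 2]) [0..<k])) = 10 * k"
  "length (concat (map (\<lambda>j. [0, d] @ concat (map (\<lambda>i. [3 * i + U ! j ! i, 1, d]) [0..<d])) [0..<k])) =
     k * (2 + 3 * d)"
  "length (concat (map (\<lambda>l. [d] @ map (\<lambda>i. 3 * i + 1 + V ! l ! i) [0..<d]) [0..<k])) = k * (1 + d)"
proof -
  show "length (concat (map (\<lambda>i. [1, 2, 3 * i + 1, 3 * i + 2, 1, 1, 3 * i + 1, 1, 1, 3 * i + 2]) [0..<k])) = 10 * k"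
    by (induction k) simp_all
  have "length (concat (map (\<lambda>i. [3 * i + U ! j ! i, 1, d]) [0..<k])) = 3 * k" for j k
    by (induction k) simp_all
  then show "length (concat (map (\<lambda>j. [0, d] @ concat (map (\<lambda>i. [3 * i + U ! j ! i, 1, d]) [0..<d])) [0..<k])) =
     k * (2 + 3 * d)"
    by (induction k) simp_all
  show "length (concat (map (\<lambda>l. [d] @ map (\<lambda>i. 3 * i + 1 + V ! l ! i) [0..<d]) [0..<k])) = k * (1 + d)"
    by (induction k) simp_all
qed

lemma lengths_le_ov_size:
  "d \<le> ov_size d U V" "length U \<le> ov_size d U V" "length V \<le> ov_size d U V" "1 \<le> ov_size d U V"
  "d + length U + length V + length U * d + length V * d \<le> 2 * ov_size d U V"
  using d_pos by (cases d; simp add: ov_size_def algebra_simps)+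

lemma length_ov_query_code: "length ov_query_code \<le> 40 * ov_size d U V"
proof -
  have "length ov_query_code =
      1 + 10 * d + 2 + (length U + 1) + 3 + length U * (2 + 3 * d) + 1 + length V * (1 + d) + 1"
    unfolding ov_query_code_def length_append length_code_parts by simp
  also have "\<dots> = 9 + 10 * d + 3 * length U + length V + 3 * (length U * d) + length V * d"
    by (simp add: algebra_simps)
  also have "\<dots> \<le> 40 * ov_size d U V"
    using lengths_le_ov_size by linarith
  finally show ?thesis .
qed

text \<open>The preserved \<open>constants\<close> includes that all registers from 20 on are still
  0, which is what the query algorithm needs in order to be started afterwards. The factors 100 and
  500 are crude.\<close>

lemma wp_query_writer:
  assumes W: "100 * ov_size d U V < W"
  shows "wp W (query_writer b)
    (\<lambda>t s. t \<le> 500 * ov_size d U V \<and>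
      (\<exists>R. s = writing (ov_code N) ((if b then [3 * d] else []) @ ov_query_code) R \<and>
        constants d (length U) (length V) R))
    (init_state (ov_code N))"
proof -
  let ?X = "ov_code N" and ?m = "length U" and ?n = "length V"
  let ?code1 = "\<lambda>i::nat. [1, 2, 3 * i + 1, 3 * i + 2, 1, 1, 3 * i + 1, 1, 1, 3 * i + 2]"
  let ?code3 = "\<lambda>U j. [0, d] @ concat (map (\<lambda>i. [3 * i + U ! j ! i, 1, d]) [0..<d])"
  let ?code4 = "\<lambda>V j. [d] @ map (\<lambda>i. 3 * i + 1 + V ! j ! i) [0..<d]"
  define out0 where "out0 = (if b then [3 * d] else []) @ [3 * d + 2 + ?m]"
  define out1 where "out1 = out0 @ concat (map ?code1 [0..<d])"
  define out2 where "out2 = (out1 @ [1, ?m + 1]) @ map (\<lambda>j. 3 * d + 1 + j) [0..<?m + 1]"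
  define out3 where "out3 = (out2 @ [1, 1, 3 * d + 1]) @ concat (map (?code3 U) [0..<?m])"
  define out4 where "out4 = ((out3 @ [?n + 1]) @ concat (map (?code4 V) [0..<?n])) @ [0]"
  define reaches where "reaches out p s \<longleftrightarrow>
    (\<exists>R. s = writing ?X out R \<and> constants d ?m ?n R \<and> R 5 = p)" for out p s
  have out4: "out4 = (if b then [3 * d] else []) @ ov_query_code"
    unfolding out4_def out3_def out2_def out1_def out0_def ov_query_code_def by simp
  have len0: "length out0 \<le> 2"
    by (simp add: out0_def)
  have len1: "length out1 \<le> 2 + 10 * d"
    using len0 unfolding out1_def length_append length_code_parts by simp
  have len2: "length out2 \<le> 5 + 10 * d + ?m"
    using len1 unfolding out2_def by simp
  have len3: "length out3 \<le> 8 + 10 * d + ?m + ?m * (2 + 3 * d)"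
    using len2 unfolding out3_def length_append length_code_parts by simp
  note size = lengths_le_ov_size
  have init: "wp W (query_writer_init b) (\<lambda>t s. t \<le> 30 \<and> reaches out0 4 s) (init_state ?X)"
  proof -
    have X: "array_of ?X 1 = d" "array_of ?X 2 = ?m" "array_of ?X 3 = ?n"
      by (simp_all add: array_of_def ov_code_def numeral_2_eq_2 numeral_3_eq_3 One_nat_def)
    have "3 * d + ?m + 10 < W"
      using size W by linarith
    then show ?thesis
      unfolding init_state_eq_writing query_writer_init_def reaches_def
      by (cases b) (simp_all add: wp_writing X, (intro writing_exI, simp_all add: out0_def constants_def)+)
  qed
  have coordinates: "wp W (for_loop 7 9 2 coordinate_body) (\<lambda>t s. t \<le> 3 + d * 33 \<and> reaches out1 4 s) s"
    if "reaches out0 4 s" for s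
  proof -
    from that obtain R where R: "s = writing ?X out0 R" "constants d ?m ?n R" "R 5 = 4"
      by (auto simp: reaches_def)
    have *: "length out0 + 10 * d + 3 * d + 10 < W"
      using len0 size W by linarith
    show ?thesis
      unfolding R(1) by (rule wp_coordinate_loop[OF R(2) *]) (use R(3) in \<open>auto simp: reaches_def out1_def\<close>)
  qed
  have start: "wp W (seqs [emit 1, emit 16, for_loop 7 9 16 start_body])
      (\<lambda>t s. t \<le> 8 + (?m + 1) * 33 \<and> reaches out2 4 s) s" if "reaches out1 4 s" for s
  proof -
    from that obtain R where R: "s = writing ?X out1 R" "constants d ?m ?n R" "R 5 = 4"
      by (auto simp: reaches_def)
    have *: "length (out1 @ [1, ?m + 1]) + ?m + 3 * d + 10 < W"
      using len1 size W by simp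
    have "wp W (for_loop 7 9 16 start_body)
        (\<lambda>t s. 2 + (2 + (t + 1)) \<le> 8 + (?m + 1) * 33 \<and> reaches out2 4 s) (writing ?X (out1 @ [1, ?m + 1]) R)"
      by (rule wp_start_loop[OF R(2) *]) (use R(3) in \<open>auto simp: reaches_def out2_def\<close>)
    then show ?thesis
      using * constantsD[OF R(2)] unfolding R(1) by (simp add: wp_writing)
  qed
  have vecs: "wp W (seqs [emit 1, emit 1, emit 17,
        for_loop 6 8 3 (seqs [emit 12, emit 2, for_loop 7 9 2 vector_body])])
      (\<lambda>t s. t \<le> 10 + ?m * (13 + d * 33) \<and> reaches out3 (4 + ?m * d) s) s" if "reaches out2 4 s" for s
  proof -
    from that obtain R where R: "s = writing ?X out2 R" "constants d ?m ?n R" "R 5 = 4"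
      by (auto simp: reaches_def)
    have *: "length (out2 @ [1, 1, 3 * d + 1]) + ?m * (2 + 3 * d) + 3 * d + 4 + ?m * d + d + 10 < W"
      using len2 size W by (simp add: algebra_simps)
    have "wp W (for_loop 6 8 3 (seqs [emit 12, emit 2, for_loop 7 9 2 vector_body]))
        (\<lambda>t s. 2 + (2 + (2 + (t + 1))) \<le> 10 + ?m * (13 + d * 33) \<and> reaches out3 (4 + ?m * d) s)
        (writing ?X (out2 @ [1, 1, 3 * d + 1]) R)"
    proof (rule wp_vectors_loop[OF R(2,3) _ *])
      show "array_of ?X (4 + j * d + i) = U ! j ! i \<and> U ! j ! i \<le> 1" if "j < ?m" "i < d" for j i
        using that array_of_ov_code(1) coord_le_1(1) by simp
    qed (auto simp: reaches_def out3_def)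
    then show ?thesis
      using * constantsD[OF R(2)] unfolding R(1) by (simp add: wp_writing)
  qed
  have tgts: "wp W (seqs [Op Add 10 4 1, emit 10,
        for_loop 6 8 4 (seqs [emit 2, for_loop 7 9 2 target_body]), emit 12])
      (\<lambda>t s. t \<le> 9 + ?n * (13 + d * 33) \<and>
        (\<exists>R. s = writing ?X out4 R \<and> constants d ?m ?n R)) s" if "reaches out3 (4 + ?m * d) s" for s
  proof -
    from that obtain R where R: "s = writing ?X out3 R" "constants d ?m ?n R" "R 5 = 4 + ?m * d"
      by (auto simp: reaches_def)
    let ?R = "R(10 := ?n + 1)"
    have R': "constants d ?m ?n ?R" "?R 5 = 4 + ?m * d"
      using R(2,3) by (simp_all add: constants_upd)
    have *: "length (out3 @ [?n + 1]) + ?n * (1 + d) + 3 * d + (4 + ?m * d) + ?n * d + d + 10 < W"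
      using len3 size W by (simp add: algebra_simps)
    have "wp W (for_loop 6 8 4 (seqs [emit 2, for_loop 7 9 2 target_body]))
        (\<lambda>t s. wp W (emit 12) (\<lambda>t' s. 1 + (2 + (t + (t' + 1))) \<le> 9 + ?n * (13 + d * 33) \<and>
          (\<exists>R. s = writing ?X out4 R \<and> constants d ?m ?n R)) s)
        (writing ?X (out3 @ [?n + 1]) ?R)"
    proof (rule wp_targets_loop[OF R' _ *])
      show "array_of ?X (4 + ?m * d + j * d + i) = V ! j ! i \<and> V ! j ! i \<le> 1" if "j < ?n" "i < d" for j i
        using that array_of_ov_code(2) coord_le_1(2) by simp
    next
      fix t R'' assume t: "t \<le> 3 + ?n * (13 + d * 33)" and R'': "constants d ?m ?n R''"
      have len: "length ((out3 @ [?n + 1]) @ concat (map (?code4 V) [0..<?n])) + 1 < W"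
        using * unfolding length_append length_code_parts by simp
      then show "wp W (emit 12) (\<lambda>t' s. 1 + (2 + (t + (t' + 1))) \<le> 9 + ?n * (13 + d * 33) \<and>
          (\<exists>R. s = writing ?X out4 R \<and> constants d ?m ?n R))
          (writing ?X ((out3 @ [?n + 1]) @ concat (map (?code4 V) [0..<?n])) R'')"
        using t R'' constantsD[OF R''] by (subst wp_writing_emit) (auto simp: out4_def)
    qed
    moreover have "?n + 1 < W"
      using size W by linarith
    ultimately show ?thesis
      using * constantsD[OF R(2)] unfolding R(1) by (simp add: wp_writing)
  qed
  have "30 + (3 + d * 33 + (8 + (?m + 1) * 33 + (10 + ?m * (13 + d * 33) + (9 + ?n * (13 + d * 33)))))
      \<le> 500 * ov_size d U V"
    using size by (simp add: algebra_simps)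
  with wp_Seq_bounded[OF init wp_Seq_bounded[OF coordinates wp_Seq_bounded[OF start wp_Seq_bounded[OF vecs tgts]]]]
  show ?thesis
    unfolding query_writer_def out4[symmetric] by (auto elim!: wp_mono)
qed

end

text \<open>Array 3 is the output array of the renamed algorithm. Registers 12 and 13 lie below the
  shift and still hold 0 and \<open>3 * d\<close>, so the answer is fetched from cell 0 for the
  membership problem and from the entry of the start vertex for the winning set.\<close>

definition ov_solver :: "bool \<Rightarrow> cmd \<Rightarrow> cmd" where
  "ov_solver b p =
     Seq (query_writer b) (Seq (shift_cmd 20 2 p) (seqs [Load 10 3 (if b then 12 else 13), Store 1 12 10]))"

lemma (in ov_reduction) exec_ov_solver:
  assumes W: "100 * ov_size d U V < W"
    and p: "exec W p (init_state ((if b then [3 * d] else []) @ ov_query_code)) t s"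
  obtains t' s' where "exec W (ov_solver b p) (init_state (ov_code N)) t' s'"
    "t' \<le> 500 * ov_size d U V + t + 3" "arr s' 1 0 = arr s 1 (if b then 0 else 3 * d)"
proof -
  let ?ys = "(if b then [3 * d] else []) @ ov_query_code"
  obtain t1 R where 1: "exec W (query_writer b) (init_state (ov_code N)) t1 (writing (ov_code N) ?ys R)"
    and t1: "t1 \<le> 500 * ov_size d U V" and R: "constants d (length U) (length V) R"
    using wp_query_writer[OF W, of b N] unfolding wp_def by blast
  let ?w = "writing (ov_code N) ?ys R"
  \<comment> \<open>Seen through the shift, the state left by the writer is a fresh machine with
    input \<open>?ys\<close>; the state itself serves as the frame.\<close>
  have "embeds 20 2 ?w (init_state ?ys) ?w"
    using constantsD(11)[OF R]
    by (auto simp: embeds_def writing_def init_state_def array_of_def fun_eq_iff)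
  from exec_shift_cmd[OF p this] obtain s2 where
    2: "exec W (shift_cmd 20 2 p) ?w t s2" and s2: "embeds 20 2 ?w s s2"
    by blast
  have regs: "reg s2 12 = 0" "reg s2 13 = 3 * d"
    using s2 constantsD[OF R] by (simp_all add: embeds_def writing_def)
  have "arr s2 3 = arr s 1"
    using s2 unfolding embeds_def by (metis one_plus_numeral semiring_norm(3))
  then have "wp W (seqs [Load 10 3 (if b then 12 else 13), Store 1 12 10])
      (\<lambda>t s'. t = 3 \<and> arr s' 1 0 = arr s 1 (if b then 0 else 3 * d)) s2"
    using regs by (simp add: wp_Seq wp_Load wp_Store wp_Skip)
  then obtain s3 where 3: "exec W (seqs [Load 10 3 (if b then 12 else 13), Store 1 12 10]) s2 3 s3"
    and s3: "arr s3 1 0 = arr s 1 (if b then 0 else 3 * d)"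
    unfolding wp_def by blast
  have "exec W (ov_solver b p) (init_state (ov_code N)) (t1 + (t + 3)) s3"
    unfolding ov_solver_def using 1 2 3 by (intro exec_Seq)
  with that[OF this _ s3] t1 show ?thesis
    by simp
qed

section \<open>Non-emptiness of the winning set\<close>

definition loop_mdp :: "nat mdp" where
  "loop_mdp = \<lparr>verts = {0}, edges = {(0, 0)}, player1 = {0}, random = {}, delta = (\<lambda>_. return_pmf 0)\<rparr>"

definition loop_query :: "nat set list \<Rightarrow> query" where
  "loop_query Ts = \<lparr>model = loop_mdp, targets = Ts\<rparr>"

lemma successors_loop_mdp: "successors loop_mdp 0 = {0}"
  by (simp add: successors_def loop_mdp_def)

lemma loop_query_in_queries:
  assumes "Ts \<noteq> []" "\<And>T. T \<in> set Ts \<Longrightarrow> T \<subseteq> {0}"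
  shows "loop_query Ts \<in> queries"
proof -
  have "is_mdp loop_mdp"
    unfolding is_mdp_def using successors_loop_mdp by (simp add: loop_mdp_def)
  then show ?thesis
    using assms by (auto simp: queries_def loop_query_def loop_mdp_def)
qed

lemma winning_set_loop_query: "winning_set (loop_query Ts) \<noteq> {} \<longleftrightarrow> {0} \<in> set Ts"
  if "\<And>T. T \<in> set Ts \<Longrightarrow> T \<subseteq> {0}"
proof
  assume "winning_set (loop_query Ts) \<noteq> {}"
  then obtain i \<sigma> x where i: "i < length Ts"
    and win: "measure (play_measure loop_mdp \<sigma> x) (Reach (Ts ! i)) = 1"
    by (auto simp: disjunctive_reach_query_def almost_sure_winning_def loop_query_def)
  have "Ts ! i \<noteq> {}"
    using win by (auto simp: Reach_def)
  moreover have "Ts ! i \<subseteq> {0}"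
    using i that by simp
  ultimately have "Ts ! i = {0}"
    by blast
  with i show "{0} \<in> set Ts"
    by (metis nth_mem)
next
  assume "{0} \<in> set Ts"
  then obtain i where i: "i < length Ts" "Ts ! i = {0}"
    by (auto simp: in_set_conv_nth)
  define \<sigma> :: "nat list \<Rightarrow> nat" where "\<sigma> = (\<lambda>_. 0)"
  have "strategy loop_mdp \<sigma>"
    using successors_loop_mdp by (auto simp: strategy_def \<sigma>_def loop_mdp_def)
  moreover have "measure (play_measure loop_mdp \<sigma> 0) (Reach {0}) = 1"
    unfolding measure_Reach_eq_1_iff using AE_play_measure_support
  proof (rule eventually_mono)
    fix \<omega> assume "\<forall>n. \<omega> n \<in> set_pmf (next_vertex loop_mdp \<sigma> 0 (map \<omega> [0..<n]))"
    then have "\<omega> 0 \<in> {0}"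
      by (metis list.map_disc_iff next_vertex_def set_return_pmf upt_0 upt_conv_Nil le_refl)
    then show "\<exists>i. \<omega> i \<in> {0}"
      by blast
  qed
  ultimately have "0 \<in> almost_sure_winning loop_mdp (Reach (Ts ! i))"
    using i by (auto simp: almost_sure_winning_def loop_mdp_def)
  with i(1) show "winning_set (loop_query Ts) \<noteq> {}"
    by (auto simp: disjunctive_reach_query_def loop_query_def)
qed

lemma encode_loop_query:
  "encode_query (loop_query Ts) =
     [1, 1, 1, 0, length Ts] @ concat (map (\<lambda>T. card T # sorted_list_of_set T) Ts)"
proof -
  have "encode_vertex loop_mdp 0 = [1, 1, 0]"
    unfolding encode_vertex_def successors_loop_mdp by (simp add: loop_mdp_def)
  moreover have "card (verts loop_mdp) = 1"
    by (simp add: loop_mdp_def)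
  ultimately show ?thesis
    by (simp add: encode_query_def loop_query_def One_nat_def)
qed

lemma encode_loop_query_empty:
  "encode_query (loop_query (replicate k {})) = [1, 1, 1, 0, k] @ replicate k 0"
  by (simp add: encode_loop_query)

lemma encode_loop_query_single:
  assumes "j < k"
  shows "encode_query (loop_query ((replicate k {})[j := {0}])) =
    [1, 1, 1, 0, k] @ replicate j 0 @ [1, 0] @ replicate (k - Suc j) 0"
proof -
  have *: "concat (replicate n [0]) = replicate n (0::nat)" for n
    by (induction n) simp_all
  show ?thesis
    using assms by (simp add: encode_loop_query upd_conv_take_nth_drop * min_def)
qed

text \<open>
  The codes of \<open>k\<close> empty targets and of the same list with one nonempty target differ in a single
  cell, since cells beyond the input are 0, so that an algorithm which takes less than \<open>k\<close> steps
  errs on one of them.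
\<close>

lemma nonempty_problem_time_ge:
  assumes p: "\<And>q. q \<in> queries \<Longrightarrow> \<exists>t s. exec (word_bound c (encode_query q)) p
      (init_state (encode_query q)) t s \<and> real t \<le> f q \<and> arr s 1 0 = of_bool (winning_set q \<noteq> {})"
    and "0 < k"
  shows "real k \<le> f (loop_query (replicate k {}))"
proof (rule ccontr)
  let ?q = "loop_query (replicate k {})"
  have "?q \<in> queries"
    using \<open>0 < k\<close> by (intro loop_query_in_queries) auto
  then obtain t s where
    exec: "exec (word_bound c (encode_query ?q)) p (init_state (encode_query ?q)) t s"
    and t: "real t \<le> f ?q" and out: "arr s 1 0 = of_bool (winning_set ?q \<noteq> {})"
    using p by blast
  assume "\<not> real k \<le> f ?q"
  then have "t < k"
    using t by linarith
  from exec_reads_within[OF exec, of 0] obtain R where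
    R: "finite R" "card R \<le> t" "reads_within 0 (word_bound c (encode_query ?q)) p (init_state (encode_query ?q)) t s R"
    by blast
  \<comment> \<open>The first 5 cells hold the MDP and \<open>k\<close>. Fewer than \<open>k\<close>
    loads leave the cell of some target unread.\<close>
  have "card ((\<lambda>j. 5 + j) ` {..<k}) = k"
    by (subst card_image) (auto simp: inj_on_def)
  then have "\<not> (\<lambda>j. 5 + j) ` {..<k} \<subseteq> R"
    using card_mono[OF R(1), of "(\<lambda>j. 5 + j) ` {..<k}"] R(2) \<open>t < k\<close> by linarith
  then obtain j where j: "j < k" "5 + j \<notin> R"
    by auto
  let ?q' = "loop_query ((replicate k {})[j := {0}])"
  have sub: "T \<subseteq> {0}" if "T \<in> set ((replicate k {})[j := {0}])" for T :: "nat set"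
    using that set_update_subset_insert[of "replicate k {}" j "{0 :: nat}"] by auto
  have "?q' \<in> queries"
    using \<open>0 < k\<close> sub by (intro loop_query_in_queries) auto
  then obtain t' s' where
    exec': "exec (word_bound c (encode_query ?q')) p (init_state (encode_query ?q')) t' s'"
    and out': "arr s' 1 0 = of_bool (winning_set ?q' \<noteq> {})"
    using p by blast
  have "agree_off 0 (5 + j) (init_state (encode_query ?q)) (init_state (encode_query ?q'))"
    unfolding encode_loop_query_empty encode_loop_query_single[OF j(1)]
    by (auto simp: agree_off_def init_state_def nth_append nth_Cons' split: if_splits)
  with R(3) j(2) obtain s'' where
    "exec (word_bound c (encode_query ?q)) p (init_state (encode_query ?q')) t s''"
    and s'': "agree_off 0 (5 + j) s s''"
    unfolding reads_within_def by blast
  \<comment> \<open>The second code is one entry longer and its maximum is no smaller. The run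
    transferred from the first code is thus also a run under the second word bound, where
    determinism applies.\<close>
  moreover have "word_bound c (encode_query ?q) \<le> word_bound c (encode_query ?q')"
    unfolding word_bound_def encode_loop_query_empty encode_loop_query_single[OF j(1)]
    using j(1) by (intro power_mono add_mono Max_mono) auto
  ultimately have "s'' = s'"
    using exec_deterministic[OF exec'] exec_mono by blast
  then have "arr s' 1 0 = arr s 1 0"
    using s'' by (simp add: agree_off_def)
  moreover have "winning_set ?q = {}"
    using winning_set_loop_query[of "replicate k {}"] by auto
  moreover have "winning_set ?q' \<noteq> {}"
    using winning_set_loop_query[OF sub] j(1) by (simp add: set_update_memI)
  ultimately show False
    using out out' by simp
qed

lemma num_edges_loop_query: "num_edges (loop_query Ts) = 1"
  by (simp add: loop_query_def loop_mdp_def)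

lemma not_solvable_nonempty_problem:
  assumes "\<And>C. \<exists>k>0. C * f (loop_query (replicate k {})) < real k"
  shows "\<not> solvable_in_time nonempty_problem f"
proof
  assume "solvable_in_time nonempty_problem f"
  then obtain p c C where "\<forall>q\<in>queries. \<exists>t s. exec (word_bound c (encode_query q)) p
      (init_state (encode_query q)) t s \<and> real t \<le> C * f q \<and> arr s 1 0 = of_bool (winning_set q \<noteq> {})"
    unfolding solvable_in_time_def nonempty_problem_def by auto
  from nonempty_problem_time_ge[OF bspec[OF this]] assms[of C] show False
    by (meson not_less)
qed

text \<open>On the single-vertex queries \<open>m = 1\<close>, so the first bound is constant and
  the second is \<open>k powr (1 - \<epsilon>)\<close>, while \<open>k\<close> steps are
  necessary.\<close>

lemma not_solvable_nonempty_problem_powr: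
  assumes "0 < \<epsilon>"
  shows "\<not> solvable_in_time nonempty_problem (\<lambda>q. num_edges q powr a)"
    and "\<not> solvable_in_time nonempty_problem (\<lambda>q. (num_targets q * num_edges q) powr (1 - \<epsilon>))"
proof -
  have "\<exists>k>0. C < real k" for C
    by (metis less_trans of_nat_0_less_iff reals_Archimedean2 less_eq_real_def not_le gt_ex max_less_iff_conj)
  then show "\<not> solvable_in_time nonempty_problem (\<lambda>q. num_edges q powr a)"
    by (intro not_solvable_nonempty_problem) (simp add: num_edges_loop_query)
  have "\<exists>k>0. C * real k powr (1 - \<epsilon>) < real k" for C
  proof -
    have "filterlim (\<lambda>k. real k powr \<epsilon>) at_top sequentially"
      using assms by real_asymp
    then have "eventually (\<lambda>k. C < real k powr \<epsilon> \<and> 0 < k) sequentially"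
      by (intro eventually_conj) (auto simp: filterlim_at_top_dense eventually_gt_at_top)
    then obtain k where k: "C < real k powr \<epsilon>" "0 < k"
      by (metis (mono_tags, lifting) eventually_sequentially le_refl)
    then have "C * real k powr (1 - \<epsilon>) < real k powr \<epsilon> * real k powr (1 - \<epsilon>)"
      by (intro mult_strict_right_mono) auto
    also have "\<dots> = real k"
      using k(2) by (simp flip: powr_add)
    finally show ?thesis
      using k(2) by blast
  qed
  then show "\<not> solvable_in_time nonempty_problem (\<lambda>q. (num_targets q * num_edges q) powr (1 - \<epsilon>))"
    by (intro not_solvable_nonempty_problem) (simp add: num_edges_loop_query, simp add: loop_query_def)
qed

section \<open>Transferring running times\<close>

lemma solvable_in_time_mono:
  assumes "solvable_in_time Q f" and "\<And>x. x \<in> instances Q \<Longrightarrow> 0 \<le> f x \<and> f x \<le> g x"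
  shows "solvable_in_time Q g"
proof -
  from assms(1) obtain p c C where p: "\<And>x. x \<in> instances Q \<Longrightarrow> \<exists>t s.
      exec (word_bound c (encode Q x)) p (init_state (encode Q x)) t s \<and>
      real t \<le> C * f x \<and> correct Q x (arr s 1)"
    unfolding solvable_in_time_def by blast
  \<comment> \<open>The constant of a running time may be any real, so its absolute value is taken
    before enlarging the bound.\<close>
  have "C * f x \<le> \<bar>C\<bar> * g x" if "x \<in> instances Q" for x
    using assms(2)[OF that] by (intro mult_mono) auto
  then have "\<forall>x\<in>instances Q. \<exists>t s. exec (word_bound c (encode Q x)) p (init_state (encode Q x)) t s \<and>
      real t \<le> \<bar>C\<bar> * g x \<and> correct Q x (arr s 1)"
    using p by (meson order_trans)
  then show ?thesis
    unfolding solvable_in_time_def by blast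
qed

text \<open>Squaring \<open>2 * c + 200 + ?X\<close> produces a multiple of \<open>?X\<close>
  exceeding \<open>200 * ?X\<close>, so a linear growth of the input is paid for by doubling the
  exponent, and the word size changes only by a constant factor.\<close>

lemma word_bound_mono:
  assumes "length ys + Max (insert 0 (set ys)) \<le> 200 * (length xs + Max (insert 0 (set xs)))"
  shows "word_bound c ys \<le> word_bound (2 * c + 200) xs"
proof -
  let ?X = "length xs + Max (insert 0 (set xs))"
  have "word_bound c ys \<le> (c + 200 * ?X) ^ c"
    unfolding word_bound_def using assms by (intro power_mono) auto
  also have "c + 200 * ?X \<le> (2 * c + 200 + ?X) ^ 2"
    by (simp add: power2_eq_square algebra_simps)
  then have "(c + 200 * ?X) ^ c \<le> ((2 * c + 200 + ?X) ^ 2) ^ c"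
    by (intro power_mono) auto
  also have "\<dots> = (2 * c + 200 + ?X) ^ (2 * c)"
    by (simp add: power_mult)
  also have "\<dots> \<le> (2 * c + 200 + ?X) ^ (2 * c + 200)"
    by (intro power_increasing) auto
  also have "\<dots> = word_bound (2 * c + 200) xs"
    by (simp add: word_bound_def add.assoc)
  finally show ?thesis .
qed

context ov_reduction
begin

text \<open>If \<open>U\<close> and \<open>V\<close> are empty, the length of the code does not
  bound \<open>d\<close>; but \<open>d\<close> is itself an entry and so bounded by the
  maximum.\<close>

lemma ov_size_le_ov_code: "ov_size d U V \<le> length (ov_code N) + Max (insert 0 (set (ov_code N)))"
proof -
  have "length (concat (U @ V)) = length (U @ V) * d"
    using vectors by (intro concat_nth_uniform) auto
  then have "ov_size d U V \<le> d + length (ov_code N)"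
    by (simp add: ov_size_def ov_code_def algebra_simps)
  moreover have "d \<le> Max (insert 0 (set (ov_code N)))"
    by (intro Max_ge) (auto simp: ov_code_def)
  ultimately show ?thesis
    by linarith
qed

lemma ov_query_code_le:
  assumes "x \<in> set ov_query_code"
  shows "x \<le> 10 * ov_size d U V"
proof -
  let ?B = "3 * d + 2 + length U + length V"
  have 1: "3 * i + 2 \<le> 3 * d" if "i < d" for i
    using that by linarith
  have 2: "3 * i + U ! j ! i \<le> ?B" if "j < length U" "i < d" for i j
    using that 1[OF that(2)] coord_le_1(1)[of "U ! j" i] by simp
  have 3: "3 * i + 1 + V ! j ! i \<le> ?B" if "j < length V" "i < d" for i j
    using that 1[OF that(2)] coord_le_1(2)[of "V ! j" i] by simp
  have "\<forall>x\<in>set ov_query_code. x \<le> ?B"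
    unfolding ov_query_code_def set_append set_concat set_map ball_Un
  proof (intro conjI)
    show "\<forall>x\<in>\<Union> (set ` (\<lambda>i. [1, 2, 3 * i + 1, 3 * i + 2, 1, 1, 3 * i + 1, 1, 1, 3 * i + 2]) ` set [0..<d]). x \<le> ?B"
      using 1 by fastforce
    show "\<forall>x\<in>\<Union> (set ` (\<lambda>j. [0, d] @ concat (map (\<lambda>i. [3 * i + U ! j ! i, 1, d]) [0..<d])) ` set [0..<length U]). x \<le> ?B"
      using 2 by auto
    show "\<forall>x\<in>\<Union> (set ` (\<lambda>l. [d] @ map (\<lambda>i. 3 * i + 1 + V ! l ! i) [0..<d]) ` set [0..<length V]). x \<le> ?B"
      using 3 by auto
  qed auto
  with assms have "x \<le> ?B"
    by blast
  then show ?thesis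
    using lengths_le_ov_size by linarith
qed

lemma ov_query_code_small:
  "length ((if b then [3 * d] else []) @ ov_query_code) +
     Max (insert 0 (set ((if b then [3 * d] else []) @ ov_query_code)))
   \<le> 200 * (length (ov_code N) + Max (insert 0 (set (ov_code N))))"
proof -
  have "Max (insert 0 (set ((if b then [3 * d] else []) @ ov_query_code))) \<le> 10 * ov_size d U V"
    using ov_query_code_le lengths_le_ov_size(1) by (subst Max_le_iff) auto
  moreover have "length ((if b then [3 * d] else []) @ ov_query_code) \<le> 41 * ov_size d U V"
    using length_ov_query_code lengths_le_ov_size(4) by auto
  moreover have "m + l \<le> 200 * n" if "l \<le> 10 * s" "m \<le> 41 * s" "s \<le> n" for l m n s :: nat
    using that by linarith
  ultimately show ?thesis
    using ov_size_le_ov_code by blast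
qed

lemma ov_size_less_word_bound: "100 * ov_size d U V < word_bound (2 * c + 200) (ov_code N)"
proof -
  let ?X = "length (ov_code N) + Max (insert 0 (set (ov_code N)))"
  have "100 * ov_size d U V \<le> 100 * ?X"
    by (rule mult_le_mono2[OF ov_size_le_ov_code])
  also have "\<dots> < (2 * c + 200 + ?X) ^ 2"
    by (simp add: power2_eq_square algebra_simps)
  also have "\<dots> \<le> (2 * c + 200 + ?X) ^ (2 * c + 200)"
    by (intro power_increasing) auto
  finally show ?thesis
    by (simp add: word_bound_def add.assoc)
qed

end

text \<open>One transfer for both problems: with \<open>b\<close> the input is preceded by the start
  vertex and the answer is in cell 0, without \<open>b\<close> the answer is the entry of the start
  vertex in the characteristic vector.\<close>

lemma solvable_ov_problem:
  assumes "0 < c\<^sub>1"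
    and p: "\<And>d U V. ov_reduction d U V \<Longrightarrow>
      \<exists>t s. exec (word_bound c ((if b then [3 * d] else []) @ encode_query (ov_query d U V))) p
          (init_state ((if b then [3 * d] else []) @ encode_query (ov_query d U V))) t s \<and>
        real t \<le> C * (real (length ((if b then [3 * d] else []) @ encode_query (ov_query d U V))) +
          g (ov_query d U V)) \<and>
        arr s 1 (if b then 0 else 3 * d) = of_bool (3 * d \<in> winning_set (ov_query d U V))"
    and g: "\<And>N d U V. ov_reduction d U V \<Longrightarrow> (N, d, U, V) \<in> instances (ov_problem c\<^sub>1 c\<^sub>2) \<Longrightarrow>
      0 \<le> g (ov_query d U V) \<and> g (ov_query d U V) \<le> K * real N powr a \<and>
      real (ov_size d U V) \<le> K * real N powr a"
  shows "solvable_in_time (ov_problem c\<^sub>1 c\<^sub>2) (\<lambda>(N, d, U, V). real N powr a)"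
proof -
  \<comment> \<open>503 is 500 for writing the query plus 3 for moving the answer, since
    \<open>ov_size\<close> is at least 1; 42 is 41 for the length of the code plus 1 for
    \<open>g\<close>.\<close>
  have "\<exists>t s. exec (word_bound (2 * c + 200) (encode (ov_problem c\<^sub>1 c\<^sub>2) x)) (ov_solver b p)
        (init_state (encode (ov_problem c\<^sub>1 c\<^sub>2) x)) t s \<and>
      real t \<le> (503 * K + \<bar>C\<bar> * (42 * K)) * (case x of (N, d, U, V) \<Rightarrow> real N powr a) \<and>
      correct (ov_problem c\<^sub>1 c\<^sub>2) x (arr s 1)"
    if x: "x \<in> instances (ov_problem c\<^sub>1 c\<^sub>2)" for x
  proof -
    obtain N d U V where [simp]: "x = (N, d, U, V)"
      by (cases x) auto
    from x have N: "2 \<le> N" "c\<^sub>1 * log 2 (real N) \<le> real d"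
      and vec: "\<And>u. u \<in> set U \<union> set V \<Longrightarrow> length u = d \<and> set u \<subseteq> {0, 1}"
      by (auto simp: ov_problem_def)
    \<comment> \<open>The lower bound on the dimension makes \<open>d\<close> positive, as the
      uniform draw over the coordinates requires.\<close>
    have "0 < c\<^sub>1 * log 2 (real N)"
      using N(1) \<open>0 < c\<^sub>1\<close> by simp
    with N(2) have "0 < d"
      by linarith
    with vec interpret ov_reduction d U V
      by unfold_locales auto
    note loc = ov_reduction_axioms
    let ?ys = "(if b then [3 * d] else []) @ ov_query_code"
    let ?W = "word_bound (2 * c + 200) (ov_code N)"
    have enc: "encode (ov_problem c\<^sub>1 c\<^sub>2) x = ov_code N"
      by (simp add: ov_problem_def ov_code_def)
    from p[OF loc] obtain t s where
      exec: "exec (word_bound c ?ys) p (init_state ?ys) t s"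
      and t: "real t \<le> C * (real (length ?ys) + g (ov_query d U V))"
      and out: "arr s 1 (if b then 0 else 3 * d) = of_bool (3 * d \<in> winning_set (ov_query d U V))"
      unfolding encode_query_ov_query by blast
    have "exec ?W p (init_state ?ys) t s"
      using exec word_bound_mono[OF ov_query_code_small] by (rule exec_mono)
    from exec_ov_solver[OF ov_size_less_word_bound this] obtain t' s' where
      exec': "exec ?W (ov_solver b p) (init_state (ov_code N)) t' s'"
      and t': "t' \<le> 500 * ov_size d U V + t + 3"
      and out': "arr s' 1 0 = arr s 1 (if b then 0 else 3 * d)"
      by blast
    have g': "0 \<le> g (ov_query d U V)" "g (ov_query d U V) \<le> K * real N powr a"
      "real (ov_size d U V) \<le> K * real N powr a"
      using g[OF loc] x by auto
    have len: "length ?ys \<le> 41 * ov_size d U V"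
      using length_ov_query_code lengths_le_ov_size(4) by auto
    have "real (length ?ys) + g (ov_query d U V) \<le> 42 * (K * real N powr a)"
      using g' len by linarith
    then have "C * (real (length ?ys) + g (ov_query d U V)) \<le> \<bar>C\<bar> * (42 * (K * real N powr a))"
      using g'(1) by (intro mult_mono) auto
    moreover have "real t' \<le> 503 * real (ov_size d U V) + real t"
      using t' lengths_le_ov_size(4) by linarith
    ultimately have "real t' \<le> 503 * (K * real N powr a) + \<bar>C\<bar> * (42 * (K * real N powr a))"
      using t g'(3) by linarith
    also have "\<dots> = (503 * K + \<bar>C\<bar> * (42 * K)) * real N powr a"
      by (simp add: algebra_simps)
    finally have "real t' \<le> (503 * K + \<bar>C\<bar> * (42 * K)) * real N powr a" .
    moreover have "correct (ov_problem c\<^sub>1 c\<^sub>2) x (arr s' 1)"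
      using out out' start_winning_iff by (simp add: ov_problem_def)
    ultimately show ?thesis
      using exec' unfolding enc by auto
  qed
  then show ?thesis
    unfolding solvable_in_time_def by blast
qed

section \<open>Absorbing the logarithmic dimension into the exponent\<close>

lemma log2_le_powr:
  assumes "0 < \<delta>" "1 \<le> x"
  shows "log 2 x \<le> x powr \<delta> / (\<delta> * ln 2)"
  using ln_powr_bound[OF assms(2,1)] by (simp add: log_def field_simps)

lemma dimension_bound:
  assumes "0 < \<delta>" "0 < c"
  obtains A where "0 < A"
    "\<And>N d. 2 \<le> N \<Longrightarrow> real d \<le> c * log 2 (real N) \<Longrightarrow> real d * real N \<le> A * real N powr (1 + \<delta>)"
proof
  show "0 < c / (\<delta> * ln 2)"
    using assms by simp
  fix N d :: nat assume N: "2 \<le> N" "real d \<le> c * log 2 (real N)"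
  have "log 2 (real N) \<le> real N powr \<delta> / (\<delta> * ln 2)"
    using N(1) assms(1) by (intro log2_le_powr) auto
  then have "c * log 2 (real N) \<le> c * (real N powr \<delta> / (\<delta> * ln 2))"
    using assms(2) by (intro mult_left_mono) auto
  with N(2) have "real d * real N \<le> c * (real N powr \<delta> / (\<delta> * ln 2)) * real N"
    by (intro mult_right_mono) auto
  also have "\<dots> = c / (\<delta> * ln 2) * real N powr (1 + \<delta>)"
    using N(1) by (simp add: powr_add)
  finally show "real d * real N \<le> c / (\<delta> * ln 2) * real N powr (1 + \<delta>)" .
qed

lemma powr_le_powr_mult:
  fixes x y :: real
  assumes "0 \<le> y" "y \<le> A * x powr b" "0 \<le> A" "1 \<le> x" "0 \<le> e" "b * e \<le> a"
  shows "y powr e \<le> A powr e * x powr a"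
proof -
  have "y powr e \<le> (A * x powr b) powr e"
    using assms by (intro powr_mono2) auto
  also have "\<dots> = A powr e * x powr (b * e)"
    using assms by (simp add: powr_mult powr_powr)
  also have "\<dots> \<le> A powr e * x powr a"
    using assms by (intro mult_left_mono powr_mono) auto
  finally show ?thesis .
qed

text \<open>The constants are chosen in a fixed order: the conjecture at
  \<open>\<epsilon> / 2\<close> yields the range of dimensions, this yields \<open>A\<close>, and
  only then \<open>K\<close> is known. Hence the hypothesis on \<open>g\<close> must supply
  \<open>K\<close> for every \<open>A\<close>.\<close>

lemma not_solvable_of_OVC:
  assumes OVC and \<epsilon>: "0 < \<epsilon>" "\<epsilon> \<le> 1"
    and g_nonneg: "\<And>q. 0 \<le> g q"
    and g: "\<And>A. 0 < A \<Longrightarrow> \<exists>K. \<forall>N d U V. ov_reduction d U V \<longrightarrow> 2 \<le> N \<longrightarrow> length V \<le> N \<longrightarrow>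
        num_edges (ov_query d U V) \<le> A * real N powr (1 + \<epsilon> / 4) \<longrightarrow>
        g (ov_query d U V) \<le> K * real N powr (2 - \<epsilon> / 2)"
  shows "\<not> solvable_in_time winning_set_problem (\<lambda>q. input_length winning_set_problem q + g q)"
    and "\<not> solvable_in_time membership_problem (\<lambda>(q, v). input_length membership_problem (q, v) + g q)"
proof -
  let ?a = "2 - \<epsilon> / 2"
  from \<open>OVC\<close> \<epsilon> obtain c\<^sub>1 c\<^sub>2 where c: "0 < c\<^sub>1" "c\<^sub>1 \<le> c\<^sub>2"
    and hard: "\<not> solvable_in_time (ov_problem c\<^sub>1 c\<^sub>2) (\<lambda>(N, d, U, V). real N powr ?a)"
    unfolding OVC_def by (meson half_gt_zero)
  obtain A where A: "0 < A" "\<And>N d. 2 \<le> N \<Longrightarrow> real d \<le> c\<^sub>2 * log 2 (real N) \<Longrightarrow>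
      real d * real N \<le> A * real N powr (1 + \<epsilon> / 4)"
    using dimension_bound[of "\<epsilon> / 4" c\<^sub>2] \<epsilon> c by auto
  \<comment> \<open>12 is the sum of the coefficients 8 and 4 in \<open>card_edges_le\<close>, both
    terms being bounded through \<open>d * N\<close>.\<close>
  obtain K where K: "\<And>N d U V. ov_reduction d U V \<Longrightarrow> 2 \<le> N \<Longrightarrow> length V \<le> N \<Longrightarrow>
      num_edges (ov_query d U V) \<le> 12 * A * real N powr (1 + \<epsilon> / 4) \<Longrightarrow>
      g (ov_query d U V) \<le> K * real N powr ?a"
    using g[of "12 * A"] A(1) by auto
  have bounds: "0 \<le> g (ov_query d U V) \<and> g (ov_query d U V) \<le> (\<bar>K\<bar> + 3 * A) * real N powr ?a \<and>
      real (ov_size d U V) \<le> (\<bar>K\<bar> + 3 * A) * real N powr ?a"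
    if red: "ov_reduction d U V" and x: "(N, d, U, V) \<in> instances (ov_problem c\<^sub>1 c\<^sub>2)" for N d U V
  proof -
    interpret ov_reduction d U V
      by (rule red)
    from x have N: "2 \<le> N" "real d \<le> c\<^sub>2 * log 2 (real N)" "length U \<le> N" "length V \<le> N"
      by (auto simp: ov_problem_def)
    note dN = A(2)[OF N(1,2)]
    have le: "d \<le> d * N" "d * length U \<le> d * N" "d * length V \<le> d * N"
      using N by simp_all
    have "card (edges (ov_mdp d U)) \<le> 12 * (d * N)"
      using card_edges_le le by linarith
    then have "num_edges (ov_query d U V) \<le> 12 * (real d * real N)"
      unfolding ov_query_simps by (metis of_nat_le_iff of_nat_mult of_nat_numeral)
    with dN have "num_edges (ov_query d U V) \<le> 12 * A * real N powr (1 + \<epsilon> / 4)"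
      by linarith
    with K[OF red N(1,4)] have "g (ov_query d U V) \<le> K * real N powr ?a"
      by blast
    also have "\<dots> \<le> (\<bar>K\<bar> + 3 * A) * real N powr ?a"
      using A(1) by (intro mult_right_mono) auto
    finally have 1: "g (ov_query d U V) \<le> (\<bar>K\<bar> + 3 * A) * real N powr ?a" .
    have "ov_size d U V \<le> 3 * (d * N)"
      using le unfolding ov_size_def by linarith
    then have "real (ov_size d U V) \<le> 3 * (real d * real N)"
      by (metis of_nat_le_iff of_nat_mult of_nat_numeral)
    also have "\<dots> \<le> 3 * A * real N powr (1 + \<epsilon> / 4)"
      using dN by simp
    \<comment> \<open>Here \<open>\<epsilon> \<le> 1\<close> enters: it gives
      \<open>1 + \<epsilon> / 4 \<le> 2 - \<epsilon> / 2\<close>, so writing the query is cheaper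
      than the bound to be refuted.\<close>
    also have "\<dots> \<le> 3 * A * real N powr ?a"
      using A(1) N(1) \<epsilon> by (intro mult_left_mono powr_mono) auto
    also have "\<dots> \<le> (\<bar>K\<bar> + 3 * A) * real N powr ?a"
      by (intro mult_right_mono) auto
    finally show ?thesis
      using 1 g_nonneg by blast
  qed
  show "\<not> solvable_in_time winning_set_problem (\<lambda>q. input_length winning_set_problem q + g q)"
  proof
    assume "solvable_in_time winning_set_problem (\<lambda>q. input_length winning_set_problem q + g q)"
    then obtain p c C where p: "\<forall>q\<in>queries. \<exists>t s. exec (word_bound c (encode_query q)) p
        (init_state (encode_query q)) t s \<and> real t \<le> C * (real (length (encode_query q)) + g q) \<and>
        (\<forall>v\<in>verts (model q). arr s 1 v = of_bool (v \<in> winning_set q))"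
      unfolding solvable_in_time_def winning_set_problem_def input_length_def by auto
    have "solvable_in_time (ov_problem c\<^sub>1 c\<^sub>2) (\<lambda>(N, d, U, V). real N powr ?a)"
    proof (rule solvable_ov_problem[where b = False, OF c(1) _ bounds])
      fix d U V assume "ov_reduction d U V"
      then interpret ov_reduction d U V .
      have "3 * d \<in> verts (model (ov_query d U V))"
        by simp
      with p ov_query_in_queries
      show "\<exists>t s. exec (word_bound c ((if False then [3 * d] else []) @ encode_query (ov_query d U V))) p
          (init_state ((if False then [3 * d] else []) @ encode_query (ov_query d U V))) t s \<and>
        real t \<le> C * (real (length ((if False then [3 * d] else []) @ encode_query (ov_query d U V))) +
          g (ov_query d U V)) \<and>
        arr s 1 (if False then 0 else 3 * d) = of_bool (3 * d \<in> winning_set (ov_query d U V))"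
        unfolding if_False append_Nil by blast
    qed
    with hard show False ..
  qed
  show "\<not> solvable_in_time membership_problem (\<lambda>(q, v). input_length membership_problem (q, v) + g q)"
  proof
    assume "solvable_in_time membership_problem (\<lambda>(q, v). input_length membership_problem (q, v) + g q)"
    then obtain p c C where p: "\<forall>(q, v)\<in>{(q, v). q \<in> queries \<and> v \<in> verts (model q)}.
        \<exists>t s. exec (word_bound c (v # encode_query q)) p
        (init_state (v # encode_query q)) t s \<and> real t \<le> C * (real (length (v # encode_query q)) + g q) \<and>
        arr s 1 0 = of_bool (v \<in> winning_set q)"
      unfolding solvable_in_time_def membership_problem_def input_length_def
      by (auto simp: case_prod_beta)
    have "solvable_in_time (ov_problem c\<^sub>1 c\<^sub>2) (\<lambda>(N, d, U, V). real N powr ?a)"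
    proof (rule solvable_ov_problem[where b = True, OF c(1) _ bounds])
      fix d U V assume "ov_reduction d U V"
      then interpret ov_reduction d U V .
      have "(ov_query d U V, 3 * d) \<in> {(q, v). q \<in> queries \<and> v \<in> verts (model q)}"
        using ov_query_in_queries by simp
      from bspec[OF p this]
      show "\<exists>t s. exec (word_bound c ((if True then [3 * d] else []) @ encode_query (ov_query d U V))) p
          (init_state ((if True then [3 * d] else []) @ encode_query (ov_query d U V))) t s \<and>
        real t \<le> C * (real (length ((if True then [3 * d] else []) @ encode_query (ov_query d U V))) +
          g (ov_query d U V)) \<and>
        arr s 1 (if True then 0 else 3 * d) = of_bool (3 * d \<in> winning_set (ov_query d U V))"
        unfolding if_True append_Cons append_Nil prod.case .
    qed
    with hard show False ..
  qed
qed

text \<open>Bases strictly between 0 and 1 would reverse the inequality; for a natural base only 0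
  is special, and there both sides are 0.\<close>

lemma of_nat_powr_mono: "a \<le> b \<Longrightarrow> real n powr a \<le> real n powr b"
  by (cases "n = 0") (auto intro: powr_mono)

lemma not_solvable_num_edges_powr:
  assumes OVC "0 < \<epsilon>"
  shows "\<not> solvable_in_time winning_set_problem
      (\<lambda>q. input_length winning_set_problem q + num_edges q powr (2 - \<epsilon>))"
    and "\<not> solvable_in_time membership_problem
      (\<lambda>(q, v). input_length membership_problem (q, v) + num_edges q powr (2 - \<epsilon>))"
proof -
  \<comment> \<open>A larger \<open>\<epsilon>\<close> only lowers the bound, so it may be cut off
    at 1, which keeps the exponents \<open>2 - e\<close> and \<open>1 - e\<close>
    nonnegative.\<close>
  define e where "e = min \<epsilon> 1"
  have e: "0 < e" "e \<le> 1" "e \<le> \<epsilon>"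
    using assms(2) by (auto simp: e_def)
  have "\<exists>K. \<forall>N d U V. ov_reduction d U V \<longrightarrow> 2 \<le> N \<longrightarrow> length V \<le> N \<longrightarrow>
      num_edges (ov_query d U V) \<le> A * real N powr (1 + e / 4) \<longrightarrow>
      num_edges (ov_query d U V) powr (2 - \<epsilon>) \<le> K * real N powr (2 - e / 2)" if "0 < A" for A
  proof (intro exI allI impI)
    fix N d :: nat and U V :: "nat list list"
    assume N: "2 \<le> N" and *: "num_edges (ov_query d U V) \<le> A * real N powr (1 + e / 4)"
    have "num_edges (ov_query d U V) powr (2 - \<epsilon>) \<le> num_edges (ov_query d U V) powr (2 - e)"
      using e by (intro of_nat_powr_mono) simp
    also have "\<dots> \<le> A powr (2 - e) * real N powr (2 - e / 2)"
      by (rule powr_le_powr_mult[OF of_nat_0_le_iff *]) (use N \<open>0 < A\<close> e in \<open>auto simp: algebra_simps\<close>)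
    finally show "num_edges (ov_query d U V) powr (2 - \<epsilon>) \<le> A powr (2 - e) * real N powr (2 - e / 2)" .
  qed
  from not_solvable_of_OVC[where g = "\<lambda>q. num_edges q powr (2 - \<epsilon>)", OF assms(1) e(1,2) powr_ge_zero this]
  show "\<not> solvable_in_time winning_set_problem
      (\<lambda>q. input_length winning_set_problem q + num_edges q powr (2 - \<epsilon>))"
    and "\<not> solvable_in_time membership_problem
      (\<lambda>(q, v). input_length membership_problem (q, v) + num_edges q powr (2 - \<epsilon>))"
    by blast+
qed

lemma not_solvable_num_targets_num_edges_powr:
  assumes OVC "0 < \<epsilon>"
  shows "\<not> solvable_in_time winning_set_problem
      (\<lambda>q. input_length winning_set_problem q + (num_targets q * num_edges q) powr (1 - \<epsilon>))"
    and "\<not> solvable_in_time membership_problem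
      (\<lambda>(q, v). input_length membership_problem (q, v) + (num_targets q * num_edges q) powr (1 - \<epsilon>))"
proof -
  define e where "e = min \<epsilon> 1"
  have e: "0 < e" "e \<le> 1" "e \<le> \<epsilon>"
    using assms(2) by (auto simp: e_def)
  have "\<exists>K. \<forall>N d U V. ov_reduction d U V \<longrightarrow> 2 \<le> N \<longrightarrow> length V \<le> N \<longrightarrow>
      num_edges (ov_query d U V) \<le> A * real N powr (1 + e / 4) \<longrightarrow>
      (num_targets (ov_query d U V) * num_edges (ov_query d U V)) powr (1 - \<epsilon>) \<le>
        K * real N powr (2 - e / 2)" if "0 < A" for A
  proof (intro exI allI impI)
    fix N d :: nat and U V :: "nat list list"
    assume N: "2 \<le> N" "length V \<le> N" and m: "num_edges (ov_query d U V) \<le> A * real N powr (1 + e / 4)"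
    let ?x = "num_targets (ov_query d U V) * num_edges (ov_query d U V)"
    \<comment> \<open>There are \<open>length V + 1\<close> targets, counting the empty one.\<close>
    have "num_targets (ov_query d U V) \<le> 2 * real N"
      using N by simp
    then have "?x \<le> 2 * real N * (A * real N powr (1 + e / 4))"
      using m by (rule mult_mono) (simp_all del: ov_query_simps)
    also have "\<dots> = 2 * A * (real N powr 1 * real N powr (1 + e / 4))"
      using N by simp
    also have "\<dots> = 2 * A * real N powr (2 + e / 4)"
      unfolding powr_add[symmetric] by simp
    finally have *: "?x \<le> 2 * A * real N powr (2 + e / 4)" .
    have "?x powr (1 - \<epsilon>) \<le> ?x powr (1 - e)"
      unfolding of_nat_mult[symmetric] by (rule of_nat_powr_mono) (use e in simp)
    \<comment> \<open>The exponent is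
      \<open>(2 + e / 4) * (1 - e) = 2 - 7 * e / 4 - e^2 / 4\<close>, which is at most
      \<open>2 - e / 2\<close>.\<close>
    also have "\<dots> \<le> (2 * A) powr (1 - e) * real N powr (2 - e / 2)"
      by (rule powr_le_powr_mult[OF mult_nonneg_nonneg[OF of_nat_0_le_iff of_nat_0_le_iff] *])
         (use N \<open>0 < A\<close> e in \<open>auto simp: algebra_simps\<close>)
    finally show "?x powr (1 - \<epsilon>) \<le> (2 * A) powr (1 - e) * real N powr (2 - e / 2)" .
  qed
  from not_solvable_of_OVC[where g = "\<lambda>q. (num_targets q * num_edges q) powr (1 - \<epsilon>)",
      OF assms(1) e(1,2) powr_ge_zero this]
  show "\<not> solvable_in_time winning_set_problem
      (\<lambda>q. input_length winning_set_problem q + (num_targets q * num_edges q) powr (1 - \<epsilon>))"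
    and "\<not> solvable_in_time membership_problem
      (\<lambda>(q, v). input_length membership_problem (q, v) + (num_targets q * num_edges q) powr (1 - \<epsilon>))"
    by blast+
qed

lemma not_solvable_without_input_length:
  assumes "\<And>x. x \<in> instances Q \<Longrightarrow> 0 \<le> f x" "\<not> solvable_in_time Q (\<lambda>x. input_length Q x + f x)"
  shows "\<not> solvable_in_time Q f"
  using assms solvable_in_time_mono[of Q f "\<lambda>x. input_length Q x + f x"]
  by (auto simp: input_length_def)

theorem theorem3:
  fixes \<epsilon> :: real
  assumes "OVC" and "\<epsilon> > 0"
  shows
    "\<not> solvable_in_time winning_set_problem (\<lambda>q. num_edges q powr (2 - \<epsilon>)) \<and>
     \<not> solvable_in_time winning_set_problem (\<lambda>q. (num_targets q * num_edges q) powr (1 - \<epsilon>)) \<and>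
     \<not> solvable_in_time nonempty_problem (\<lambda>q. num_edges q powr (2 - \<epsilon>)) \<and>
     \<not> solvable_in_time nonempty_problem (\<lambda>q. (num_targets q * num_edges q) powr (1 - \<epsilon>)) \<and>
     \<not> solvable_in_time membership_problem (\<lambda>(q, v). num_edges q powr (2 - \<epsilon>)) \<and>
     \<not> solvable_in_time membership_problem
          (\<lambda>(q, v). (num_targets q * num_edges q) powr (1 - \<epsilon>)) \<and>
     (\<comment> \<open>even if time linear in the length of the input is granted in addition\<close>
      \<not> solvable_in_time winning_set_problem
          (\<lambda>q. input_length winning_set_problem q + num_edges q powr (2 - \<epsilon>)) \<and>
      \<not> solvable_in_time winning_set_problem
          (\<lambda>q. input_length winning_set_problem q
                + (num_targets q * num_edges q) powr (1 - \<epsilon>)) \<and>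
      \<not> solvable_in_time membership_problem
          (\<lambda>(q, v). input_length membership_problem (q, v) + num_edges q powr (2 - \<epsilon>)) \<and>
      \<not> solvable_in_time membership_problem
          (\<lambda>(q, v). input_length membership_problem (q, v)
                + (num_targets q * num_edges q) powr (1 - \<epsilon>)))"
proof (intro conjI)
  note edges = not_solvable_num_edges_powr[OF assms]
  note targets_edges = not_solvable_num_targets_num_edges_powr[OF assms]
  show "\<not> solvable_in_time winning_set_problem (\<lambda>q. num_edges q powr (2 - \<epsilon>))"
    using edges(1) by (rule not_solvable_without_input_length[rotated]) simp
  show "\<not> solvable_in_time winning_set_problem (\<lambda>q. (num_targets q * num_edges q) powr (1 - \<epsilon>))"
    using targets_edges(1) by (rule not_solvable_without_input_length[rotated]) simp
  show "\<not> solvable_in_time membership_problem (\<lambda>(q, v). num_edges q powr (2 - \<epsilon>))"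
    using edges(2) unfolding case_prod_unfold prod.collapse
    by (rule not_solvable_without_input_length[rotated]) simp
  show "\<not> solvable_in_time membership_problem (\<lambda>(q, v). (num_targets q * num_edges q) powr (1 - \<epsilon>))"
    using targets_edges(2) unfolding case_prod_unfold prod.collapse
    by (rule not_solvable_without_input_length[rotated]) simp
qed (fact not_solvable_num_edges_powr[OF assms] not_solvable_num_targets_num_edges_powr[OF assms]
      not_solvable_nonempty_problem_powr[OF assms(2)])+

end
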